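(* Let $q$ be a prime power. If $q\notin\{2,3,4,5,8\}$, then $P_{\mathrm{comp}}(\mathbb{F}_q)=P_{\mathrm{orth}}(\mathbb{F}_q)=\mathrm{Sym}(\mathbb{F}_q)$. For the remaining values of $q$: (i) $P_{\mathrm{comp}}(\mathbb{F}_2)=P_{\mathrm{orth}}(\mathbb{F}_2)=\{\mathrm{id}\}$; (ii) $P_{\mathrm{comp}}(\mathbb{F}_3)=\mathrm{Alt}(\mathbb{F}_3)$ and $P_{\mathrm{orth}}(\mathbb{F}_3)=\mathrm{Sym}(\mathbb{F}_3)$; (iii) $P_{\mathrm{comp}}(\mathbb{F}_4)=P_{\mathrm{orth}}(\mathbb{F}_4)=\mathrm{Alt}(\mathbb{F}_4)$; (iv) $P_{\mathrm{comp}}(\mathbb{F}_5)=P_{\mathrm{orth}}(\mathbb{F}_5)=\mathrm{AGL}_1(5)$; (v) $P_{\mathrm{comp}}(\mathbb{F}_8)=P_{\mathrm{orth}}(\mathbb{F}_8)=\mathrm{AGL}_3(2)$. In particular, both $P_{\mathrm{comp}}(\mathbb{F}_q)$ and $P_{\mathrm{orth}}(\mathbb{F}_q)$ are primitive permutation groups on $\mathbb{F}_q$ if $q\geq 3$.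
   Context: $\mathbb{F}_q$ is the finite field with $q$ elements. A complete mapping of $\mathbb{F}_q$ is a permutation $f$ of $\mathbb{F}_q$ such that $x\mapsto x+f(x)$ is also a permutation of $\mathbb{F}_q$; an orthomorphism of $\mathbb{F}_q$ is a permutation $f$ of $\mathbb{F}_q$ such that $x\mapsto -x+f(x)$ is also a permutation of $\mathbb{F}_q$. $P_{\mathrm{comp}}(\mathbb{F}_q)$, respectively $P_{\mathrm{orth}}(\mathbb{F}_q)$, denotes the subgroup of the symmetric group $\mathrm{Sym}(\mathbb{F}_q)$ (under composition) generated by all complete mappings, respectively all orthomorphisms, of $\mathbb{F}_q$. $\mathrm{Alt}(\mathbb{F}_q)$ is the subgroup of even permutations. For $q=p^d$ with $p$ prime, $\mathrm{AGL}_d(p)\leq\mathrm{Sym}(\mathbb{F}_q)$ is the group of all $\mathbb{F}_p$-affine permutations $x\mapsto A(x)+b$ of $\mathbb{F}_q$, regarded as a $d$-dimensional $\mathbb{F}_p$-vector space ($A$ an $\mathbb{F}_p$-linear automorphism, $b\in\mathbb{F}_q$). *)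

theory Defs
  imports
    "HOL-Algebra.Group_Action"
    "HOL-Algebra.Generated_Groups"
    "HOL-Combinatorics.Permutations"
    "HOL-Number_Theory.Prime_Powers"
begin

definition complete_mapping :: "('a::{field,finite} \<Rightarrow> 'a) \<Rightarrow> bool" where
  "complete_mapping f \<longleftrightarrow> bij f \<and> bij (\<lambda>x. x + f x)"

definition orthomorphism :: "('a::{field,finite} \<Rightarrow> 'a) \<Rightarrow> bool" where
  "orthomorphism f \<longleftrightarrow> bij f \<and> bij (\<lambda>x. - x + f x)"

text \<open>
  On the universe of a type, extensionality is vacuous: the elements of \<open>BijGroup UNIV\<close> are
  exactly the bijections, and its multiplication is composition.
\<close>

abbreviation SymGroup :: "('a \<Rightarrow> 'a) monoid" where
  "SymGroup \<equiv> BijGroup UNIV"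

definition P_comp :: "('a::{field,finite} \<Rightarrow> 'a) set" where
  "P_comp = generate SymGroup {f. complete_mapping f}"

definition P_orth :: "('a::{field,finite} \<Rightarrow> 'a) set" where
  "P_orth = generate SymGroup {f. orthomorphism f}"

definition Alt :: "('a::finite \<Rightarrow> 'a) set" where
  "Alt = {f \<in> carrier SymGroup. evenperm f}"

text \<open>
  In a finite field of characteristic \<open>p\<close> the multiples of \<open>1\<close> are \<open>0, \<dots>, p - 1\<close>, and they form
  the subfield of order \<open>p\<close>.
\<close>

definition prime_subfield :: "'a::{field,finite} set" where
  "prime_subfield = range of_nat"

text \<open>
  If the field has \<open>p ^ d\<close> elements with \<open>p\<close> prime, it is a vector space of dimension \<open>d\<close> over
  its prime subfield, so the following set is the affine group \<open>AGL\<^sub>d(p)\<close>.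
  Both \<open>p\<close> and \<open>d\<close> are determined by the type.
\<close>

definition AGL :: "('a::{field,finite} \<Rightarrow> 'a) set" where
  "AGL = {f. \<exists>A b. bij A \<and> (\<forall>x y. A (x + y) = A x + A y) \<and>
               (\<forall>c\<in>prime_subfield. \<forall>x. A (c * x) = c * A x) \<and>
               f = (\<lambda>x. A x + b)}"

text \<open>
  Primitivity of a permutation group \<open>H\<close> on \<open>X\<close>: it is transitive, and its only blocks are the
  singletons and \<open>X\<close>.
\<close>

definition primitive_perm_group :: "('a \<Rightarrow> 'a) set \<Rightarrow> 'a set \<Rightarrow> bool" where
  "primitive_perm_group H X \<longleftrightarrow>
     subgroup H (BijGroup X) \<and>
     transitive_action ((BijGroup X)\<lparr>carrier := H\<rparr>) X (\<lambda>g. g) \<and>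
     (\<forall>B. B \<subseteq> X \<and> B \<noteq> {} \<and> (\<forall>g\<in>H. g ` B = B \<or> g ` B \<inter> B = {}) \<longrightarrow>
          B = X \<or> (\<exists>x. B = {x}))"

end

theory Submission
  imports Defs
    "HOL-Combinatorics.Cycles"
    "HOL-Computational_Algebra.Polynomial"
    "HOL-Number_Theory.Residues"
begin

text \<open>
  For \<open>q \<ge> 4\<close> the affine maps \<open>x \<mapsto> a x + b\<close> with \<open>a \<noteq> 0, -1\<close> are complete and generate all maps
  of this form with \<open>a \<noteq> 0\<close>. Negation is among them, it exchanges complete mappings and
  orthomorphisms, and so the two groups coincide (\<open>P_orth_eq_P_comp\<close>). The group is
  2-transitive, which settles primitivity; for \<open>q = 3\<close> it contains a 3-cycle instead.

  To reach all even permutations it is enough to find a 3-cycle or, with nine or more elements,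
  any permutation other than the identity that moves at most four points: it has an affine
  conjugate whose support meets its own in exactly one point, their commutator is a 3-cycle
  (\<open>commutator_common_point\<close>), and by 2-transitivity one 3-cycle yields the others
  (\<open>Alt_subset_if_small_support_and_affine\<close>). Such a permutation arises as the quotient of two
  complete mappings that agree outside a few points. If \<open>f\<close> is complete and \<open>\<pi>\<close> permutes a small
  set in such a way that the sums \<open>x + f (\<pi> x)\<close> are merely a rearrangement of the sums
  \<open>x + f x\<close>, then \<open>f \<circ> \<pi>\<close> is complete and \<open>\<pi>\<close> is in the group (\<open>switch_in_P_comp\<close>). Outside the
  orders \<open>2, 3, 4, 5, 8\<close>, suitable \<open>f\<close> and \<open>\<pi>\<close> are as follows.

  \<^item> If \<open>q \<equiv> 1\<close> modulo 4, then \<open>f\<close> is multiplication by a square root \<open>i\<close> of \<open>-1\<close>, and \<open>\<pi>\<close>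
    exchanges opposite corners of the square \<open>0, 1, 1 + i, i\<close>.
  \<^item> If \<open>q \<equiv> 3\<close> modulo 4, then \<open>f\<close> is a multiplication on the squares and another one on the
    nonsquares, and \<open>\<pi>\<close> is a 3-cycle \<open>(0 1 t)\<close>, where both \<open>t\<close> and \<open>1 - t\<close> are nonsquares.
  \<^item> If \<open>q \<ge> 16\<close> is a power of 2, then \<open>f\<close> is a multiplication modified on one coset of an
    additive subgroup of order four, and \<open>\<pi>\<close> is a 4-cycle.

  An odd permutation is supplied by multiplication with a primitive root if \<open>q\<close> is odd, and by
  the 4-cycle if \<open>q\<close> is even.

  In the remaining fields there are too few complete mappings for this. For \<open>q = 5\<close> and \<open>q = 8\<close>
  an exhaustive search shows that those fixing \<open>0\<close> are additive, which bounds the group by the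
  affine group. Conversely, for \<open>q = 8\<close> switching a multiplication on the complement of an
  additive subgroup of index 2 gives every transvection, and transvections generate the linear
  group. For \<open>q \<le> 4\<close> the complete mappings are determined by hand.
\<close>

section \<open>Permutation groups on a finite type\<close>

abbreviation inv' :: "('a \<Rightarrow> 'b) \<Rightarrow> 'b \<Rightarrow> 'a" where
  "inv' f \<equiv> Hilbert_Choice.inv f"

lemma carrier_SymGroup: "carrier SymGroup = {f. bij f}"
  by (auto simp: BijGroup_def Bij_def)

lemma mult_SymGroup: "bij f \<Longrightarrow> bij g \<Longrightarrow> f \<otimes>\<^bsub>SymGroup\<^esub> g = f \<circ> g"
  by (auto simp: BijGroup_def Bij_def compose_def fun_eq_iff)

lemma one_SymGroup: "\<one>\<^bsub>SymGroup\<^esub> = id"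
  by (auto simp: BijGroup_def fun_eq_iff)

lemma inv_SymGroup: "bij f \<Longrightarrow> inv\<^bsub>SymGroup\<^esub> f = inv' f"
  by (subst inv_BijGroup) (auto simp: Bij_def fun_eq_iff)

lemma subgroup_SymGroup_iff:
  "subgroup S SymGroup \<longleftrightarrow>
     (\<forall>f\<in>S. bij f) \<and> id \<in> S \<and> (\<forall>f\<in>S. \<forall>g\<in>S. f \<circ> g \<in> S) \<and> (\<forall>f\<in>S. inv' f \<in> S)"
proof
  assume S: "subgroup S SymGroup"
  have b: "bij f" if "f \<in> S" for f
    using subgroup.mem_carrier[OF S that] by (simp add: carrier_SymGroup)
  show "(\<forall>f\<in>S. bij f) \<and> id \<in> S \<and> (\<forall>f\<in>S. \<forall>g\<in>S. f \<circ> g \<in> S) \<and> (\<forall>f\<in>S. inv' f \<in> S)"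
    using b subgroup.m_closed[OF S] subgroup.m_inv_closed[OF S] subgroup.one_closed[OF S]
    by (metis inv_SymGroup mult_SymGroup one_SymGroup)
next
  assume "(\<forall>f\<in>S. bij f) \<and> id \<in> S \<and> (\<forall>f\<in>S. \<forall>g\<in>S. f \<circ> g \<in> S) \<and> (\<forall>f\<in>S. inv' f \<in> S)"
  then show "subgroup S SymGroup"
    by (intro subgroup.intro)
      (auto simp: carrier_SymGroup mult_SymGroup one_SymGroup inv_SymGroup)
qed

lemma subgroup_SymGroupD:
  assumes "subgroup S SymGroup"
  shows "f \<in> S \<Longrightarrow> bij f" "id \<in> S" "f \<in> S \<Longrightarrow> g \<in> S \<Longrightarrow> f \<circ> g \<in> S" "f \<in> S \<Longrightarrow> inv' f \<in> S"
  using assms by (auto simp: subgroup_SymGroup_iff)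

lemma permutation_finite: "bij (f :: 'a::finite \<Rightarrow> 'a) \<Longrightarrow> permutation f"
  by (simp add: permutation)

lemma subgroup_Alt: "subgroup (Alt :: ('a::finite \<Rightarrow> 'a) set) SymGroup"
  by (auto simp: subgroup_SymGroup_iff Alt_def carrier_SymGroup evenperm_comp evenperm_inv
      permutation_finite bij_comp bij_imp_bij_inv)

lemma generate_subset_SymGroup:
  assumes "subgroup S SymGroup" "X \<subseteq> S"
  shows "generate SymGroup X \<subseteq> S"
  using group.generate_subgroup_incl[OF group_BijGroup assms(2,1)] .

lemma subgroup_generate_SymGroup:
  "(\<And>f. f \<in> X \<Longrightarrow> bij f) \<Longrightarrow> subgroup (generate SymGroup X) SymGroup"
  by (rule group.generate_is_subgroup[OF group_BijGroup]) (auto simp: carrier_SymGroup)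

lemma evenperm_cycle_of_list:
  "distinct cs \<Longrightarrow> cs \<noteq> [] \<Longrightarrow> evenperm (cycle_of_list cs) \<longleftrightarrow> odd (length cs)"
proof (induction cs rule: cycle_of_list.induct)
  case (1 i j cs)
  have "evenperm (cycle_of_list (i # j # cs)) \<longleftrightarrow> (evenperm (transpose i j) \<longleftrightarrow> evenperm (cycle_of_list (j # cs)))"
    by (simp only: cycle_of_list.simps evenperm_comp[OF permutation_swap_id permutation_of_cycle])
  also have "\<dots> \<longleftrightarrow> odd (length (i # j # cs))"
    using 1 by (simp only: evenperm_swap distinct.simps) auto
  finally show ?case .
qed auto

text \<open>
  The induction follows a word in transpositions two letters at a time; for a word of odd length
  one letter is left over, so the invariant then speaks of the permutation preceded by one more
  arbitrary transposition.
\<close>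

lemma swap_pairs_generate_even:
  assumes S: "subgroup S SymGroup"
    and pairs: "\<And>a b c d. a \<noteq> b \<Longrightarrow> c \<noteq> d \<Longrightarrow> transpose a b \<circ> transpose c d \<in> S"
    and "swapidseq n p"
  shows "(even n \<longrightarrow> p \<in> S) \<and> (odd n \<longrightarrow> (\<forall>a b. a \<noteq> b \<longrightarrow> transpose a b \<circ> p \<in> S))"
  using assms(3)
proof induction
  case id
  then show ?case using subgroup_SymGroupD(2)[OF S] by (simp add: id_def)
next
  case (comp_Suc n p a b)
  then show ?case
    using pairs subgroup_SymGroupD(3)[OF S] by (metis comp_assoc even_Suc)
qed

lemma cycle3_simps:
  assumes "distinct [a, b, c]"
  shows "cycle_of_list [a, b, c] a = b" "cycle_of_list [a, b, c] b = c" "cycle_of_list [a, b, c] c = a"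
  using assms by (auto simp: transpose_def)

lemma cycle3_outside: "x \<notin> {a, b, c} \<Longrightarrow> cycle_of_list [a, b, c] x = x"
  by (rule id_outside_supp) auto

text \<open>
  Two transpositions sharing a point multiply to a 3-cycle or to the identity, and for disjoint
  ones \<open>(a b)(c d) = (a b)(b c) \<cdot> (b c)(c d)\<close>.
\<close>

lemma Alt_subset_if_3cycles:
  fixes S :: "('a::finite \<Rightarrow> 'a) set"
  assumes S: "subgroup S SymGroup"
    and cyc: "\<And>a b c. distinct [a, b, c] \<Longrightarrow> cycle_of_list [a, b, c] \<in> S"
  shows "Alt \<subseteq> S"
proof
  have one_common: "transpose a b \<circ> transpose b c \<in> S" if "a \<noteq> b" "b \<noteq> c" for a b c
    using cyc[of a b c] that subgroup_SymGroupD(2)[OF S] by (cases "a = c") (auto simp: transpose_commute)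
  have pairs: "transpose a b \<circ> transpose c d \<in> S" if "a \<noteq> b" "c \<noteq> d" for a b c d
  proof (cases "b = c")
    case False
    have "(transpose a b \<circ> transpose b c) \<circ> (transpose b c \<circ> transpose c d) = transpose a b \<circ> transpose c d"
      by (simp add: fun_eq_iff)
    then show ?thesis
      using subgroup_SymGroupD(3)[OF S one_common[of a b c] one_common[of b c d]] that False by simp
  qed (use one_common that in auto)
  fix f :: "'a \<Rightarrow> 'a" assume "f \<in> Alt"
  then obtain n where "swapidseq n f" "even n"
    by (auto simp: Alt_def carrier_SymGroup evenperm_def permutation_def dest!: permutation_finite)
       (metis someI_ex)
  then show "f \<in> S"
    using swap_pairs_generate_even[OF S pairs] by blast
qed

lemma Sym_if_Alt_and_odd:
  fixes S :: "('a::finite \<Rightarrow> 'a) set"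
  assumes S: "subgroup S SymGroup" and "Alt \<subseteq> S" "f \<in> S" "\<not> evenperm f"
  shows "S = carrier SymGroup"
proof -
  have bf: "bij f" using S assms(3) by (simp add: subgroup_SymGroupD)
  have "g \<in> S" if g: "bij g" for g
  proof (cases "evenperm g")
    case True
    then show ?thesis using assms(2) g by (auto simp: Alt_def carrier_SymGroup)
  next
    case False
    then have "inv' f \<circ> g \<in> S"
      using assms(2,4) g bf
      by (auto simp: Alt_def carrier_SymGroup evenperm_comp evenperm_inv permutation_finite bij_comp bij_imp_bij_inv)
    then have "f \<circ> (inv' f \<circ> g) \<in> S"
      using assms(3) subgroup_SymGroupD[OF S] by blast
    moreover have "f \<circ> (inv' f \<circ> g) = g"
      using bf by (auto simp: fun_eq_iff bij_is_surj surj_f_inv_f)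
    ultimately show ?thesis by simp
  qed
  then show ?thesis
    using subgroup_SymGroupD[OF S] by (auto simp: carrier_SymGroup)
qed

text \<open>
  Outside the common point \<open>a\<close> and its two images, every point is moved by at most one of the
  permutations, so that the other one cancels against its inverse; of the commutator only the
  3-cycle on \<open>a\<close>, \<open>\<sigma> a\<close>, \<open>\<tau> a\<close> survives. This is the source of all 3-cycles obtained below from
  permutations of small support.
\<close>

lemma commutator_common_point:
  assumes "bij \<sigma>" "bij \<tau>" and common: "{x. \<sigma> x \<noteq> x \<and> \<tau> x \<noteq> x} = {a}"
  shows "\<sigma> \<circ> \<tau> \<circ> inv' \<sigma> \<circ> inv' \<tau> = cycle_of_list [a, \<sigma> a, \<tau> a]"
    and "distinct [a, \<sigma> a, \<tau> a]"
proof -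
  have s: "inv' \<sigma> (\<sigma> x) = x" "\<sigma> (inv' \<sigma> x) = x" and t: "inv' \<tau> (\<tau> x) = x" "\<tau> (inv' \<tau> x) = x" for x
    using assms(1,2) by (auto simp: bij_is_inj bij_is_surj surj_f_inv_f)
  have mv: "\<sigma> a \<noteq> a" "\<tau> a \<noteq> a" using common by auto
  have fix1: "\<sigma> x = x \<or> \<tau> x = x" if "x \<noteq> a" for x using common that by auto
  have ts: "\<tau> (\<sigma> a) = \<sigma> a" "\<sigma> (\<tau> a) = \<tau> a"
    using fix1[of "\<sigma> a"] fix1[of "\<tau> a"] mv s t by metis+
  show d: "distinct [a, \<sigma> a, \<tau> a]" using mv ts s t by (simp; metis)
  have ti: "\<tau> (inv' \<sigma> a) = inv' \<sigma> a" "\<sigma> (inv' \<tau> a) = inv' \<tau> a"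
    using fix1[of "inv' \<sigma> a"] fix1[of "inv' \<tau> a"] mv s t by metis+
  show "\<sigma> \<circ> \<tau> \<circ> inv' \<sigma> \<circ> inv' \<tau> = cycle_of_list [a, \<sigma> a, \<tau> a]"
  proof
    fix x
    consider "x = a" | "x = \<sigma> a" | "x = \<tau> a" | "x \<notin> {a, \<sigma> a, \<tau> a}" by auto
    then show "(\<sigma> \<circ> \<tau> \<circ> inv' \<sigma> \<circ> inv' \<tau>) x = cycle_of_list [a, \<sigma> a, \<tau> a] x"
    proof cases
      case 1
      have "inv' \<sigma> (inv' \<tau> a) = inv' \<tau> a" using ti s by metis
      then show ?thesis using 1 t cycle3_simps[OF d] by simp
    next
      case 2
      have "inv' \<tau> (\<sigma> a) = \<sigma> a" using ts t by metis
      then show ?thesis using 2 s ts cycle3_simps[OF d] by simp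
    next
      case 3
      then show ?thesis using t s ti cycle3_simps[OF d] by simp
    next
      case 4
      have "(\<sigma> \<circ> \<tau> \<circ> inv' \<sigma> \<circ> inv' \<tau>) x = x"
      proof (cases "\<tau> x = x")
        case True
        then have "inv' \<tau> x = x" using t by metis
        moreover have "\<tau> (inv' \<sigma> x) = inv' \<sigma> x"
          using 4 s fix1[of "inv' \<sigma> x"] True by (metis insert_iff)
        ultimately show ?thesis by (simp add: s)
      next
        case False
        then have "\<sigma> x = x" using fix1 4 by auto
        moreover have "\<sigma> (inv' \<tau> x) = inv' \<tau> x"
          using 4 t fix1[of "inv' \<tau> x"] False by (metis insert_iff)
        ultimately show ?thesis using s t by (simp; metis)
      qed
      then show ?thesis using cycle3_outside 4 by metis
    qed
  qed
qed

text \<open>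
  Think of the supports of the given 3-cycles as lines. For a triple \<open>a, b, d\<close> there are a line
  through \<open>a, b\<close> and a line through \<open>a, d\<close>; if they meet in \<open>a\<close> alone, the commutator is
  \<open>(a b d)\<close>, and if they share a further point, then \<open>(a b d)\<close> is one of the two 3-cycles, a
  square or a conjugate of one.
\<close>

lemma Alt_subset_if_3cycle_through_pairs:
  fixes S :: "('a::finite \<Rightarrow> 'a) set"
  assumes S: "subgroup S SymGroup"
    and thr: "\<And>a b. a \<noteq> b \<Longrightarrow> \<exists>c. distinct [a, b, c] \<and> cycle_of_list [a, b, c] \<in> S"
  shows "Alt \<subseteq> S"
proof (rule Alt_subset_if_3cycles[OF S])
  fix a b d :: 'a assume abd: "distinct [a, b, d]"
  obtain c where c: "distinct [a, b, c]" "cycle_of_list [a, b, c] \<in> S" using thr abd by force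
  obtain e where e: "distinct [a, d, e]" "cycle_of_list [a, d, e] \<in> S" using thr abd by force
  let ?\<sigma> = "cycle_of_list [a, b, c]" and ?\<tau> = "cycle_of_list [a, d, e]"
  have bij: "bij ?\<sigma>" "bij ?\<tau>" using c e S by (auto intro: subgroup_SymGroupD)
  consider "c = d" | "e = b" | "c = e" "c \<noteq> d" "e \<noteq> b" | "distinct [a, b, c, d, e]"
    using abd c e by auto
  then show "cycle_of_list [a, b, d] \<in> S"
  proof cases
    case 1 then show ?thesis using c by simp
  next
    case 2
    have "?\<tau> \<circ> ?\<tau> = cycle_of_list [a, b, d]"
      using 2 e by (auto simp: fun_eq_iff transpose_def)
    then show ?thesis using e subgroup_SymGroupD(3)[OF S] by metis
  next
    case 3
    have "?\<sigma> \<circ> ?\<tau> \<circ> inv' ?\<sigma> = cycle_of_list (map ?\<sigma> [a, d, e])"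
      using conjugation_of_cycle[OF e(1) bij(1)] .
    also have "map ?\<sigma> [a, d, e] = [b, d, a]"
      using 3 abd c e by (auto simp: transpose_def)
    finally have "cycle_of_list [b, d, a] \<in> S"
      using c e subgroup_SymGroupD[OF S] by metis
    moreover have "cycle_of_list [b, d, a] = cycle_of_list [a, b, d]"
      using abd by (auto simp: fun_eq_iff transpose_def)
    ultimately show ?thesis by simp
  next
    case 4
    have "{x. ?\<sigma> x \<noteq> x \<and> ?\<tau> x \<noteq> x} = {a}"
      using 4 by (auto simp: transpose_def)
    from commutator_common_point(1)[OF bij this]
    have "?\<sigma> \<circ> ?\<tau> \<circ> inv' ?\<sigma> \<circ> inv' ?\<tau> = cycle_of_list [a, b, d]"
      using cycle3_simps(1) c e by metis
    then show ?thesis using c e subgroup_SymGroupD[OF S] by metis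
  qed
qed

section \<open>Complete mappings, orthomorphisms and switches\<close>

lemma bij_affine: "(a::'a::field) \<noteq> 0 \<Longrightarrow> bij (\<lambda>x. a * x + b)"
  by (rule bij_betw_byWitness[where f' = "\<lambda>x. (x - b) / a"]) auto

lemma complete_mapping_bij:
  assumes "complete_mapping f"
  shows "bij f" "bij (\<lambda>x. x + f x)"
  using assms by (auto simp: complete_mapping_def)

lemma orthomorphism_iff_complete_uminus:
  "orthomorphism f \<longleftrightarrow> complete_mapping (\<lambda>x. - f x)"
proof -
  have neg: "bij (\<lambda>x. - g x) \<longleftrightarrow> bij g" for g :: "'a \<Rightarrow> 'a"
  proof -
    have "bij (uminus :: 'a \<Rightarrow> 'a)"
      by (rule bij_betw_byWitness[where f' = uminus]) auto
    then show ?thesis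
      using bij_comp[of g uminus] bij_comp[of "\<lambda>x. - g x" uminus] by (auto simp: o_def)
  qed
  show ?thesis
    using neg[of f] neg[of "\<lambda>x. - x + f x"] by (simp add: orthomorphism_def complete_mapping_def)
qed

lemma complete_iff_orthomorphism_uminus:
  "complete_mapping f \<longleftrightarrow> orthomorphism (\<lambda>x. - f x)"
  by (simp add: orthomorphism_iff_complete_uminus)

lemma complete_mapping_affine:
  assumes "a \<noteq> 0" "a \<noteq> -1"
  shows "complete_mapping (\<lambda>x. a * x + b)"
proof -
  have "1 + a \<noteq> 0" using assms(2) by (metis add.commute add_eq_0_iff)
  then show ?thesis
    using assms bij_affine[of "1 + a" b] bij_affine[of a b]
    by (simp add: complete_mapping_def algebra_simps)
qed

lemma complete_mapping_add_const:
  assumes "complete_mapping f"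
  shows "complete_mapping (\<lambda>x. f x + c)"
proof -
  have "bij (\<lambda>x::'a. x + c)" using bij_affine[of 1 c] by simp
  then show ?thesis
    using bij_comp[of f "\<lambda>x. x + c"] bij_comp[of "\<lambda>x. x + f x" "\<lambda>x. x + c"] assms
    by (simp add: complete_mapping_def o_def add.assoc)
qed

text \<open>
  Replacing \<open>f\<close> by \<open>f \<circ> \<pi>\<close> permutes the values of \<open>f\<close> among themselves; if the values of
  \<open>x + f x\<close> are thereby permuted among themselves as well, by \<open>\<rho>\<close>, then completeness is
  preserved. In the applications \<open>\<pi>\<close> moves very few points, and this is how permutations of
  small support come to lie in the group: they are quotients of two complete mappings.
\<close>

lemma complete_mapping_switch:
  assumes f: "complete_mapping f" and "bij \<pi>" "bij \<rho>"
    and sw: "\<And>x. x + f (\<pi> x) = \<rho> x + f (\<rho> x)"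
  shows "complete_mapping (f \<circ> \<pi>)"
proof -
  have "bij ((\<lambda>x. x + f x) \<circ> \<rho>)" using assms(3) complete_mapping_bij[OF f] by (metis bij_comp)
  moreover have "(\<lambda>x. x + f x) \<circ> \<rho> = (\<lambda>x. x + (f \<circ> \<pi>) x)" by (auto simp: sw)
  ultimately show ?thesis
    using assms(2) complete_mapping_bij[OF f] by (simp add: complete_mapping_def bij_comp)
qed

lemma subgroup_P_comp: "subgroup (P_comp :: ('a::{field,finite} \<Rightarrow> 'a) set) SymGroup"
  unfolding P_comp_def by (rule subgroup_generate_SymGroup) (auto simp: complete_mapping_def)

lemma subgroup_P_orth: "subgroup (P_orth :: ('a::{field,finite} \<Rightarrow> 'a) set) SymGroup"
  unfolding P_orth_def by (rule subgroup_generate_SymGroup) (auto simp: orthomorphism_def)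

lemma complete_mapping_in_P_comp: "complete_mapping f \<Longrightarrow> f \<in> P_comp"
  unfolding P_comp_def by (rule generate.incl) simp

lemma orthomorphism_in_P_orth: "orthomorphism f \<Longrightarrow> f \<in> P_orth"
  unfolding P_orth_def by (rule generate.incl) simp

lemma P_comp_subset:
  "subgroup S SymGroup \<Longrightarrow> (\<And>f. complete_mapping f \<Longrightarrow> f \<in> S) \<Longrightarrow> P_comp \<subseteq> S"
  unfolding P_comp_def by (rule generate_subset_SymGroup) auto

lemma P_orth_subset:
  "subgroup S SymGroup \<Longrightarrow> (\<And>f. orthomorphism f \<Longrightarrow> f \<in> S) \<Longrightarrow> P_orth \<subseteq> S"
  unfolding P_orth_def by (rule generate_subset_SymGroup) auto

lemma switch_in_P_comp:
  assumes "complete_mapping f" "bij \<pi>" "bij \<rho>" "\<And>x. x + f (\<pi> x) = \<rho> x + f (\<rho> x)"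
  shows "\<pi> \<in> P_comp"
proof -
  have "inv' f \<circ> (f \<circ> \<pi>) \<in> P_comp"
    using complete_mapping_in_P_comp[OF complete_mapping_switch[OF assms]]
      complete_mapping_in_P_comp[OF assms(1)] subgroup_SymGroupD[OF subgroup_P_comp] by blast
  moreover have "inv' f \<circ> (f \<circ> \<pi>) = \<pi>"
    using complete_mapping_bij(1)[OF assms(1)] by (auto simp: fun_eq_iff bij_is_inj)
  ultimately show ?thesis by simp
qed

text \<open>
  Only the slope \<open>-1\<close> is not covered by a complete mapping; it is the product of the slopes \<open>c\<close>
  and \<open>-1 / c\<close>, which both avoid \<open>-1\<close> once \<open>c\<close> is none of \<open>0, 1, -1\<close>.
\<close>

lemma affine_in_P_comp:
  assumes "card (UNIV :: 'a::{field,finite} set) \<ge> 4" and "(a::'a) \<noteq> 0"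
  shows "(\<lambda>x. a * x + b) \<in> P_comp"
proof (cases "a = -1")
  case False
  then show ?thesis using assms complete_mapping_affine complete_mapping_in_P_comp by blast
next
  case True
  have "card {0, 1, -1 :: 'a} < card (UNIV :: 'a set)"
    using assms(1) card_insert_le_m1[of 3 "{1, -1 :: 'a}" 0] card_insert_le_m1[of 2 "{-1 :: 'a}" 1] by simp
  then obtain c :: 'a where c: "c \<notin> {0, 1, -1}"
    by (metis UNIV_eq_I order_less_irrefl)
  have "(\<lambda>x. c * x + 0) \<in> P_comp"
    using c by (intro complete_mapping_in_P_comp complete_mapping_affine) auto
  moreover have "(\<lambda>x. (- 1 / c) * x + b / c) \<in> P_comp"
    using c by (intro complete_mapping_in_P_comp complete_mapping_affine) (auto simp: field_simps)
  ultimately have "(\<lambda>x. c * x + 0) \<circ> (\<lambda>x. (- 1 / c) * x + b / c) \<in> P_comp"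
    by (rule subgroup_SymGroupD(3)[OF subgroup_P_comp])
  moreover have "(\<lambda>x. c * x + 0) \<circ> (\<lambda>x. (- 1 / c) * x + b / c) = (\<lambda>x. a * x + b)"
    using c True by (auto simp: fun_eq_iff field_simps)
  ultimately show ?thesis by simp
qed

lemma uminus_in_P_orth: "(uminus :: 'a::{field,finite} \<Rightarrow> 'a) \<in> P_orth"
proof (cases "(1::'a) = -1")
  case True
  then have "-x = id x" for x :: 'a by (metis id_apply mult_1 mult_minus1)
  then have "(uminus :: 'a \<Rightarrow> 'a) = id" by (rule ext)
  then show ?thesis using subgroup_SymGroupD(2)[OF subgroup_P_orth] by simp
next
  case False
  then show ?thesis
    using complete_mapping_affine[of "1::'a" 0] orthomorphism_iff_complete_uminus[of "uminus :: 'a \<Rightarrow> 'a"]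
      orthomorphism_in_P_orth by simp
qed

text \<open>
  Negation exchanges complete mappings and orthomorphisms, and it lies in both groups.
\<close>

lemma P_orth_eq_P_comp:
  assumes "card (UNIV :: 'a::{field,finite} set) \<ge> 4"
  shows "(P_orth :: ('a \<Rightarrow> 'a) set) = P_comp"
proof
  have neg: "(uminus :: 'a \<Rightarrow> 'a) \<in> P_comp"
    using affine_in_P_comp[OF assms, of "-1" 0] by simp
  have split: "f = uminus \<circ> (\<lambda>x. - f x)" for f :: "'a \<Rightarrow> 'a" by auto
  show "(P_orth :: ('a \<Rightarrow> 'a) set) \<subseteq> P_comp"
    by (rule P_orth_subset[OF subgroup_P_comp])
      (metis split neg subgroup_SymGroupD(3)[OF subgroup_P_comp] complete_mapping_in_P_comp orthomorphism_iff_complete_uminus)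
  show "(P_comp :: ('a \<Rightarrow> 'a) set) \<subseteq> P_orth"
    by (rule P_comp_subset[OF subgroup_P_orth])
      (metis split uminus_in_P_orth subgroup_SymGroupD(3)[OF subgroup_P_orth] orthomorphism_in_P_orth complete_iff_orthomorphism_uminus)
qed

lemma affine_two_point_transitive:
  assumes "(a::'a::field) \<noteq> b" "c \<noteq> d"
  obtains u v where "u \<noteq> 0" "u * a + v = c" "u * b + v = d"
proof
  let ?u = "(c - d) / (a - b)"
  show "?u \<noteq> 0" "?u * a + (c - ?u * a) = c" using assms by auto
  have "u * b + (c - u * a) = c - u * (a - b)" for u by (simp add: algebra_simps)
  from this[of ?u] show "?u * b + (c - ?u * a) = d" using assms by simp
qed

lemma Alt_subset_if_3cycle_and_affine:
  fixes S :: "('a::{field,finite} \<Rightarrow> 'a) set"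
  assumes S: "subgroup S SymGroup" and aff: "\<And>a b. a \<noteq> 0 \<Longrightarrow> (\<lambda>x. a * x + b) \<in> S"
    and d: "distinct [a, b, c]" and cyc: "cycle_of_list [a, b, c] \<in> S"
  shows "Alt \<subseteq> S"
proof (rule Alt_subset_if_3cycle_through_pairs[OF S])
  fix a' b' :: 'a assume "a' \<noteq> b'"
  then obtain u v where uv: "u \<noteq> 0" "u * a + v = a'" "u * b + v = b'"
    using affine_two_point_transitive[of a b a' b'] d by auto
  let ?\<alpha> = "\<lambda>x. u * x + v"
  have "?\<alpha> \<circ> cycle_of_list [a, b, c] \<circ> inv' ?\<alpha> = cycle_of_list (map ?\<alpha> [a, b, c])"
    by (rule conjugation_of_cycle[OF d bij_affine[OF uv(1)]])
  then have "cycle_of_list [a', b', ?\<alpha> c] \<in> S"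
    using subgroup_SymGroupD(3)[OF S subgroup_SymGroupD(3)[OF S aff[OF uv(1), of v] cyc]
      subgroup_SymGroupD(4)[OF S aff[OF uv(1), of v]]] uv by (simp only: list.map)
  moreover have "distinct (map ?\<alpha> [a, b, c])"
    using d bij_is_inj[OF bij_affine[OF uv(1), of v]] by (simp only: distinct_map inj_on_subset[OF _ subset_UNIV])
  then have "distinct [a', b', ?\<alpha> c]" by (simp only: list.map uv)
  ultimately show "\<exists>c. distinct [a', b', c] \<and> cycle_of_list [a', b', c] \<in> S" by blast
qed

text \<open>
  An affine map \<open>x \<mapsto> u (x - d) + d\<close> fixes a chosen point \<open>d\<close> of the support \<open>D\<close>, and it maps a
  second point \<open>y\<close> of \<open>D\<close> to a point \<open>x\<close> of \<open>D\<close> only if \<open>u = (x - d) / (y - d)\<close>. Besides \<open>0\<close> and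
  \<open>1\<close> there are at most six such ratios, so with nine elements some slope \<open>u\<close> remains for which
  the support and its image meet in \<open>d\<close> alone. The commutator of \<open>\<sigma>\<close> with its conjugate is then
  a 3-cycle.
\<close>

lemma Alt_subset_if_small_support_and_affine:
  fixes S :: "('a::{field,finite} \<Rightarrow> 'a) set"
  assumes S: "subgroup S SymGroup" and aff: "\<And>a b. a \<noteq> 0 \<Longrightarrow> (\<lambda>x. a * x + b) \<in> S"
    and \<sigma>: "\<sigma> \<in> S" "\<sigma> \<noteq> id" and D: "{x. \<sigma> x \<noteq> x} \<subseteq> D" "card D \<le> 4"
    and q: "card (UNIV :: 'a set) \<ge> 9"
  shows "Alt \<subseteq> S"
proof -
  obtain d where d: "\<sigma> d \<noteq> d" using \<sigma>(2) by (auto simp: fun_eq_iff)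
  let ?D = "D - {d}"
  let ?R = "(\<lambda>(x, y). (x - d) / (y - d)) ` (?D \<times> ?D - Id)"
  have "card ?D \<le> 3" using D d by (auto simp: card_Diff_singleton)
  have "card (?D \<times> ?D - Id) = card (?D \<times> ?D) - card ((\<lambda>x. (x, x)) ` ?D)"
    by (subst card_Diff_subset[symmetric]) (auto intro!: arg_cong[of _ _ card])
  also have "\<dots> = card ?D * card ?D - card ?D"
    by (simp add: card_cartesian_product card_image inj_on_def)
  also have "\<dots> \<le> 6"
  proof -
    have "card ?D * (card ?D - 1) \<le> 3 * 2" using \<open>card ?D \<le> 3\<close> by (intro mult_le_mono) auto
    then show ?thesis by (simp add: diff_mult_distrib2)
  qed
  finally have "card (?D \<times> ?D - Id) \<le> 6" .
  then have "card ?R \<le> 6"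
    by (rule order_trans[OF card_image_le, rotated]) simp
  then have "card ({0, 1} \<union> ?R) \<le> 8"
    using card_Un_le[of "{0, 1}" ?R] by simp
  then have "{0, 1} \<union> ?R \<noteq> UNIV" using q by auto
  then obtain u where u: "u \<notin> {0, 1} \<union> ?R" by blast
  let ?\<alpha> = "\<lambda>x. u * x + (d - u * d)"
  have b\<alpha>: "bij ?\<alpha>" using bij_affine u by blast
  define \<tau> where "\<tau> = ?\<alpha> \<circ> \<sigma> \<circ> inv' ?\<alpha>"
  have \<tau>: "\<tau> \<in> S" unfolding \<tau>_def
    using aff[of u "d - u * d"] u \<sigma>(1) subgroup_SymGroupD[OF S] by simp
  have \<tau>\<alpha>: "\<tau> (?\<alpha> x) = ?\<alpha> (\<sigma> x)" for x
    using b\<alpha> by (simp add: \<tau>_def inv_f_f[OF bij_is_inj[OF b\<alpha>]])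
  have "{x. \<sigma> x \<noteq> x \<and> \<tau> x \<noteq> x} = {d}"
  proof
    have "?\<alpha> d = d" by simp
    then have "\<tau> d = ?\<alpha> (\<sigma> d)" using \<tau>\<alpha>[of d] by metis
    moreover have "?\<alpha> (\<sigma> d) \<noteq> ?\<alpha> d" using u d by auto
    ultimately have "\<tau> d \<noteq> d" by simp
    then show "{d} \<subseteq> {x. \<sigma> x \<noteq> x \<and> \<tau> x \<noteq> x}" using d by simp
    show "{x. \<sigma> x \<noteq> x \<and> \<tau> x \<noteq> x} \<subseteq> {d}"
    proof safe
      fix x assume x: "\<sigma> x \<noteq> x" "\<tau> x \<noteq> x"
      obtain y where y: "x = ?\<alpha> y" using surjD[OF bij_is_surj[OF b\<alpha>]] by blast
      have "\<sigma> y \<noteq> y" using x(2) \<tau>\<alpha>[of y] unfolding y by auto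
      then have xy: "x \<in> D" "y \<in> D" using D x by auto
      show "x = d"
      proof (rule ccontr)
        assume "x \<noteq> d"
        then have "y \<noteq> d" using y by auto
        have "x - d = u * (y - d)" using y by (simp add: algebra_simps)
        then have "u = (x - d) / (y - d)" using \<open>y \<noteq> d\<close> by simp
        moreover from this have "x \<noteq> y" using u \<open>y \<noteq> d\<close> by auto
        ultimately have "u \<in> ?R" using xy \<open>x \<noteq> d\<close> \<open>y \<noteq> d\<close> by (auto intro!: image_eqI[of _ _ "(x, y)"])
        then show False using u by simp
      qed
    qed
  qed
  note c = commutator_common_point[OF subgroup_SymGroupD(1)[OF S \<sigma>(1)] subgroup_SymGroupD(1)[OF S \<tau>] this]
  have "\<sigma> \<circ> \<tau> \<circ> inv' \<sigma> \<circ> inv' \<tau> \<in> S"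
    using \<sigma>(1) \<tau> subgroup_SymGroupD(3,4)[OF S] by blast
  then have "cycle_of_list [d, \<sigma> d, \<tau> d] \<in> S"
    by (simp only: c(1))
  then show ?thesis using Alt_subset_if_3cycle_and_affine[OF S aff c(2)] by blast
qed

section \<open>Primitive roots and squares in finite fields\<close>

text \<open>
  The cyclicity theorem is stated for rings as records; the record whose carrier is the whole
  type carries it over.
\<close>

lemma field_units_cyclic:
  obtains g :: "'a::{field,finite}" where "g \<noteq> 0" "\<And>x. x \<noteq> 0 \<Longrightarrow> \<exists>i. x = g ^ i"
proof -
  let ?R = "\<lparr>carrier = UNIV, monoid.mult = (*), one = 1, zero = 0, add = (+)\<rparr> :: 'a ring"
  have pow: "x [^]\<^bsub>?R\<^esub> (i::nat) = x ^ i" for x :: 'a and i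
    by (induction i) (auto simp: nat_pow_def)
  have F: "Ring.field ?R"
  proof (rule cring.cring_fieldI2)
    show "cring ?R"
    proof (rule cringI)
      show "abelian_group ?R"
      proof (rule abelian_groupI)
        fix x assume "x \<in> carrier ?R"
        show "\<exists>y\<in>carrier ?R. y \<oplus>\<^bsub>?R\<^esub> x = \<zero>\<^bsub>?R\<^esub>"
          by (intro bexI[of _ "- x"]) auto
      qed (auto simp: add.assoc add.commute)
      show "comm_monoid ?R"
        by (rule comm_monoidI) (auto simp: mult.assoc mult.commute)
    qed (auto simp: algebra_simps)
    show "\<zero>\<^bsub>?R\<^esub> \<noteq> \<one>\<^bsub>?R\<^esub>" by simp
    fix a assume "a \<in> carrier ?R" "a \<noteq> \<zero>\<^bsub>?R\<^esub>"
    then show "\<exists>b\<in>carrier ?R. a \<otimes>\<^bsub>?R\<^esub> b = \<one>\<^bsub>?R\<^esub>"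
      by (auto intro!: exI[of _ "inverse a"])
  qed
  obtain a where "a \<in> carrier (mult_of ?R)"
    "carrier (mult_of ?R) = {a [^]\<^bsub>?R\<^esub> i | i::nat. i \<in> UNIV}"
    using field.finite_field_mult_group_has_gen[OF F] by auto
  then show ?thesis using that[of a] by (auto simp: pow)
qed

lemma finite_field_power_card_minus_1:
  assumes "(x::'a::{field,finite}) \<noteq> 0"
  shows "x ^ (card (UNIV :: 'a set) - 1) = 1"
proof -
  have "(\<Prod>y\<in>UNIV - {0}. x * y) = \<Prod>(UNIV - {0})"
    by (rule prod.reindex_bij_witness[of _ "\<lambda>y. y / x" "\<lambda>y. x * y"]) (use assms in auto)
  then have "x ^ (card (UNIV :: 'a set) - 1) * \<Prod>(UNIV - {0}) = 1 * \<Prod>(UNIV - {0 :: 'a})"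
    by (simp add: prod.distrib card_Diff_singleton)
  then show ?thesis by simp
qed

lemma primitive_root_list:
  obtains g :: "'a::{field,finite}" where "g \<noteq> 0"
    "distinct (map (\<lambda>i. g ^ i) [0..<card (UNIV :: 'a set) - 1])"
    "set (map (\<lambda>i. g ^ i) [0..<card (UNIV :: 'a set) - 1]) = UNIV - {0}"
proof -
  obtain g :: 'a where g: "g \<noteq> 0" "\<And>x. x \<noteq> 0 \<Longrightarrow> \<exists>i. x = g ^ i"
    using field_units_cyclic by metis
  let ?n = "card (UNIV :: 'a set) - 1"
  have "card {0, 1 :: 'a} \<le> card (UNIV :: 'a set)" by (rule card_mono) auto
  then have n: "?n > 0" by simp
  have "g ^ i = g ^ (i mod ?n)" for i
  proof -
    have "g ^ i = (g ^ ?n) ^ (i div ?n) * g ^ (i mod ?n)"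
      by (metis div_mult_mod_eq mult.commute power_add power_mult)
    then show ?thesis using finite_field_power_card_minus_1[OF g(1)] by simp
  qed
  then have s: "set (map (\<lambda>i. g ^ i) [0..<?n]) = UNIV - {0}"
    using g n by (force simp: image_iff intro: mod_less_divisor)
  moreover have "distinct (map (\<lambda>i. g ^ i) [0..<?n])"
    by (rule card_distinct) (simp only: s, simp)
  ultimately show ?thesis using that g by blast
qed

text \<open>
  Multiplication by a primitive root permutes the \<open>q - 1\<close> nonzero elements in a single cycle,
  whose length is even.
\<close>

lemma odd_permutation_mult:
  assumes "odd (card (UNIV :: 'a::{field,finite} set))"
  obtains g :: "'a::{field,finite}" where "g \<noteq> 0" "\<not> evenperm (\<lambda>x. g * x)"
proof -
  let ?n = "card (UNIV :: 'a set) - 1"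
  obtain g :: 'a where g: "g \<noteq> 0" "distinct (map (\<lambda>i. g ^ i) [0..<?n])"
    "set (map (\<lambda>i. g ^ i) [0..<?n]) = UNIV - {0}"
    by (rule primitive_root_list)
  define cs where "cs = map (\<lambda>i. g ^ i) [0..<?n]"
  have "card {0, 1 :: 'a} \<le> card (UNIV :: 'a set)" by (rule card_mono) auto
  then obtain m where m: "?n = Suc m" by (cases ?n) auto
  have "rotate1 cs = map (\<lambda>x. g * x) cs"
  proof -
    have "cs = 1 # map (\<lambda>i. g ^ Suc i) [0..<m]"
      unfolding cs_def m by (simp only: upt_conv_Cons zero_less_Suc list.map map_Suc_upt[symmetric] map_map o_def power_0)
    moreover have "map (\<lambda>x. g * x) cs = map (\<lambda>i. g ^ Suc i) [0..<m] @ [g ^ ?n]"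
      unfolding cs_def m by simp
    ultimately show ?thesis
      using finite_field_power_card_minus_1[OF g(1)] by simp
  qed
  moreover have "map (cycle_of_list cs) cs = rotate1 cs"
    using cyclic_rotation[of cs 1] g(2) by (simp add: cs_def)
  ultimately have "cycle_of_list cs x = g * x" if "x \<in> set cs" for x
    using that by (metis map_eq_conv)
  moreover have "cycle_of_list cs 0 = g * 0"
    using id_outside_supp[of 0 cs] g(3) by (simp only: cs_def) simp
  moreover have "x \<in> set cs" if "x \<noteq> 0" for x
    using g(3) that by (simp only: cs_def) simp
  ultimately have "cycle_of_list cs x = g * x" for x by (cases "x = 0") blast+
  then have "cycle_of_list cs = (\<lambda>x. g * x)" by (rule ext)
  moreover have "\<not> evenperm (cycle_of_list cs)"
  proof -
    have "length cs = Suc m" by (simp only: cs_def length_map length_upt m)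
    moreover have "card (UNIV :: 'a set) = Suc (Suc m)" using m by simp
    then have "odd m" using assms by simp
    ultimately show ?thesis using g(2) evenperm_cycle_of_list[of cs] unfolding cs_def by force
  qed
  ultimately show ?thesis using that g(1) by metis
qed

definition is_square :: "'a::field \<Rightarrow> bool" where
  "is_square x \<longleftrightarrow> (\<exists>y. x = y ^ 2)"

lemma nonsquare_mult_nonsquare:
  assumes "\<not> is_square (x::'a::{field,finite})" "\<not> is_square y"
  shows "is_square (x * y)"
proof -
  obtain g :: 'a where g: "g \<noteq> 0" "\<And>x. x \<noteq> 0 \<Longrightarrow> \<exists>i. x = g ^ i"
    using field_units_cyclic by metis
  have odd: "\<exists>i. odd i \<and> z = g ^ i" if "\<not> is_square z" for z
  proof -
    have "z \<noteq> 0" using that by (auto simp: is_square_def intro: exI[of _ 0])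
    then obtain i where "z = g ^ i" using g by blast
    moreover have "odd i"
    proof
      assume "even i"
      then obtain k where "i = k * 2" by (metis evenE mult.commute)
      then have "z = (g ^ k) ^ 2" using \<open>z = g ^ i\<close> by (simp only: power_mult)
      then show False using that by (auto simp: is_square_def)
    qed
    ultimately show ?thesis by blast
  qed
  obtain i j where ij: "odd i" "odd j" "x = g ^ i" "y = g ^ j" using odd assms by metis
  then obtain k where "i + j = k * 2" by (metis odd_even_add evenE mult.commute)
  then have "x * y = (g ^ k) ^ 2"
    by (simp only: ij power_add[symmetric] power_mult[symmetric])
  then show ?thesis by (auto simp: is_square_def)
qed

lemma one_neq_minus_one_if_odd_card:
  assumes "odd (card (UNIV :: 'a::{field,finite} set))"
  shows "(1::'a) \<noteq> -1" 
proof
  assume "(1::'a) = -1"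
  then have "(of_nat 2 :: 'a) = 0" by (simp add: eq_neg_iff_add_eq_0)
  then have "CHAR('a) dvd 2" by (simp only: of_nat_eq_0_iff_char_dvd)
  moreover have "CHAR('a) \<noteq> 1"
    using of_nat_eq_0_iff_char_dvd[where ?'a = 'a, of 1] by auto
  moreover have "CHAR('a) \<le> 2"
    using \<open>CHAR('a) dvd 2\<close> by (rule dvd_imp_le) simp
  moreover have "CHAR('a) \<noteq> 0"
    using finite_imp_CHAR_pos[where ?'a = 'a] by simp
  ultimately have "CHAR('a) = 2" by linarith
  then show False using CHAR_dvd_CARD[where 'a='a] assms by simp
qed

lemma minus_one_nonsquare:
  assumes "card (UNIV :: 'a::{field,finite} set) mod 4 = 3"
  shows "\<not> is_square (-1 :: 'a)"
proof
  let ?q = "card (UNIV :: 'a set)"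
  assume "is_square (-1 :: 'a)"
  then obtain y :: 'a where y: "y ^ 2 = -1" by (auto simp: is_square_def)
  define k where "k = ?q div 4"
  have "n - 1 = 2 * Suc (2 * (n div 4)) \<and> odd n" if "n mod 4 = 3" for n :: nat
    using that by presburger
  from this[OF assms] have q: "?q - 1 = 2 * Suc (2 * k)" "odd ?q" unfolding k_def by blast+
  have "y \<noteq> 0" using y by auto
  from finite_field_power_card_minus_1[OF this]
  have "1 = y ^ (2 * Suc (2 * k))" by (simp only: q)
  also have "\<dots> = (-1) ^ Suc (2 * k)" by (simp only: power_mult y)
  finally have "(1::'a) = -1" by simp
  then show False using one_neq_minus_one_if_odd_card q(2) by blast
qed

lemma sqrt_minus_one:
  assumes "card (UNIV :: 'a::{field,finite} set) mod 4 = 1"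
  obtains i :: "'a::{field,finite}" where "i ^ 2 = -1"
proof -
  let ?q = "card (UNIV :: 'a set)"
  obtain g :: 'a where g: "g \<noteq> 0" "distinct (map (\<lambda>i. g ^ i) [0..<?q - 1])"
    by (rule primitive_root_list)
  have "card {0, 1 :: 'a} \<le> ?q" by (rule card_mono) auto
  then have "2 \<le> ?q" by simp
  define k where "k = ?q div 4"
  have "n - 1 = 4 * (n div 4) \<and> n div 4 > 0" if "n mod 4 = 1" "2 \<le> n" for n :: nat
    using that by presburger
  from this[OF assms \<open>2 \<le> ?q\<close>] have k: "?q - 1 = 4 * k" "k > 0" unfolding k_def by blast+
  have "g ^ (2 * k) \<noteq> g ^ 0"
  proof
    have "inj_on (\<lambda>i. g ^ i) {0..<4 * k}" using g(2) by (simp only: distinct_map k(1) set_upt)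
    moreover assume "g ^ (2 * k) = g ^ 0"
    ultimately have "2 * k = 0" by (rule inj_onD) (use k(2) in auto)
    then show False using k(2) by simp
  qed
  moreover have "(g ^ (2 * k)) ^ 2 = 1"
  proof -
    have "(g ^ (2 * k)) ^ 2 = g ^ (2 * k * 2)" by (simp only: power_mult)
    also have "2 * k * 2 = 4 * k" by simp
    finally show ?thesis using finite_field_power_card_minus_1[OF g(1)] by (simp only: k(1))
  qed
  ultimately have "g ^ (2 * k) = -1" by (auto simp: power2_eq_1_iff)
  moreover have "g ^ (2 * k) = (g ^ k) ^ 2" by (simp only: mult.commute[of 2] power_mult)
  ultimately show ?thesis using that[of "g ^ k"] by simp
qed

section \<open>Fields of odd order\<close>

lemma Alt_subset_P_comp_if_small_support:
  fixes \<sigma> :: "'a::{field,finite} \<Rightarrow> 'a"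
  assumes "\<sigma> \<in> P_comp" "\<sigma> \<noteq> id" "{x. \<sigma> x \<noteq> x} \<subseteq> D" "card D \<le> 4"
    and "card (UNIV :: 'a set) \<ge> 9"
  shows "(Alt :: ('a \<Rightarrow> 'a) set) \<subseteq> P_comp"
proof (rule Alt_subset_if_small_support_and_affine[OF subgroup_P_comp _ assms])
  show "(\<lambda>x. a * x + b) \<in> P_comp" if "a \<noteq> 0" for a b :: 'a
    using affine_in_P_comp[OF _ that] assms(5) by simp
qed

text \<open>
  Multiply by a square root \<open>i\<close> of \<open>-1\<close>. Exchanging opposite corners of the unit square
  \<open>0, 1, 1 + i, i\<close> is a switch: by \<open>x + i (\<pi> x) = (1 + i) (\<rho> x)\<close>, the points \<open>x\<close>, \<open>\<rho> x\<close>, \<open>\<pi> x\<close>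
  form an isosceles triangle with its right angle at \<open>\<rho> x\<close>, and \<open>\<rho>\<close> is the quarter turn of the
  square.
\<close>

lemma Alt_subset_P_comp_1_mod_4:
  assumes "card (UNIV :: 'a::{field,finite} set) mod 4 = 1" "card (UNIV :: 'a set) \<ge> 9"
  shows "(Alt :: ('a \<Rightarrow> 'a) set) \<subseteq> P_comp"
proof -
  have "n mod 4 = 1 \<Longrightarrow> odd n" for n :: nat by presburger
  then have ne: "(1::'a) \<noteq> -1" using assms(1) one_neq_minus_one_if_odd_card by blast
  obtain i :: 'a where i2: "i ^ 2 = -1" using sqrt_minus_one[OF assms(1)] by blast
  then have ii: "i * i = -1" "i * (i * x) = - x" for x
    by (auto simp: power2_eq_square mult.assoc[symmetric])
  have d: "i \<noteq> 0" "i \<noteq> 1" "i \<noteq> -1" "1 + i \<noteq> 0" using ii ne by (auto simp: add_eq_0_iff)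
  define \<pi> where "\<pi> = transpose 0 (1 + i) \<circ> transpose 1 i"
  define \<rho> where "\<rho> = cycle_of_list [0, i, 1 + i, 1]"
  have "\<pi> \<in> P_comp"
  proof (rule switch_in_P_comp)
    show "complete_mapping (\<lambda>x. i * x + 0)" using complete_mapping_affine d by blast
    show "bij \<pi>" "bij \<rho>"
      unfolding \<pi>_def \<rho>_def
      by (intro bij_comp permutation_bijective permutation_swap_id permutation_of_cycle)+
    fix x
    have \<pi>: "\<pi> 0 = 1 + i" "\<pi> (1 + i) = 0" "\<pi> 1 = i" "\<pi> i = 1"
      using d by (auto simp: \<pi>_def transpose_def)
    have \<rho>: "\<rho> 0 = i" "\<rho> i = 1 + i" "\<rho> (1 + i) = 1" "\<rho> 1 = 0"
      using d by (auto simp: \<rho>_def transpose_def)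
    show "x + (i * \<pi> x + 0) = \<rho> x + (i * \<rho> x + 0)"
    proof (cases "x \<in> {0, i, 1 + i, 1}")
      case True
      then show ?thesis by (auto simp: \<pi> \<rho> algebra_simps ii)
    next
      case False
      then have "\<pi> x = x" "\<rho> x = x" by (auto simp: \<pi>_def \<rho>_def transpose_def)
      then show ?thesis by simp
    qed
  qed
  moreover have "\<pi> 0 \<noteq> id 0" using d by (auto simp: \<pi>_def transpose_def)
  then have "\<pi> \<noteq> id" by metis
  moreover have "{x. \<pi> x \<noteq> x} \<subseteq> {0, i, 1 + i, 1}" by (auto simp: \<pi>_def transpose_def)
  moreover have "card {0, i, 1 + i, 1} \<le> 4" by (simp add: card_insert_if)
  ultimately show ?thesis
    using assms(2) by (rule Alt_subset_P_comp_if_small_support)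
qed

text \<open>
  Since \<open>-1\<close> is not a square, the nonsquares are the negatives of the nonzero squares. If
  \<open>1 - t\<close> were a square for every nonsquare \<open>t\<close>, then \<open>t - 1\<close> would again be a nonsquare;
  starting from \<open>-1\<close> one would descend through \<open>-2, -3, \<dots>\<close> to \<open>0\<close>.
\<close>

lemma two_nonsquares_sum_one:
  assumes "card (UNIV :: 'a::{field,finite} set) mod 4 = 3"
  obtains t :: "'a::{field,finite}" where "\<not> is_square t" "\<not> is_square (1 - t)"
proof (rule ccontr)
  assume "\<not> thesis"
  with that have no: "is_square (1 - t)" if "\<not> is_square t" for t :: 'a using \<open>\<not> is_square t\<close> by blast
  have neg: "\<not> is_square (- s)" if s: "is_square s" "s \<noteq> 0" for s :: 'a
  proof
    assume "is_square (- s)"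
    with s obtain x y where xy: "s = x ^ 2" "- s = y ^ 2" by (auto simp: is_square_def)
    have "(y / x) ^ 2 = - s / s" by (simp only: power_divide xy(2)[symmetric] xy(1)[symmetric])
    then have "(y / x) ^ 2 = -1" using s(2) by simp
    then show False using minus_one_nonsquare[OF assms] unfolding is_square_def by metis
  qed
  have sq01: "is_square (0::'a)" "is_square (1::'a)"
    unfolding is_square_def by (auto intro: exI[of _ 0] exI[of _ 1])
  have nonsq: "\<not> is_square (- 1 - of_nat n :: 'a)" for n
  proof (induction n)
    case 0
    show ?case using neg[OF sq01(2)] by simp
  next
    case (Suc n)
    let ?t = "- 1 - of_nat n :: 'a"
    have "?t \<noteq> 1" using Suc sq01(2) by metis
    then have "1 - ?t \<noteq> 0" by (metis right_minus_eq)
    then have "\<not> is_square (- (1 - ?t))" using neg[OF no[OF Suc]] by blast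
    moreover have "- (1 - ?t) = - 1 - of_nat (Suc n)" by simp
    ultimately show ?case by (simp only: not_False_eq_True)
  qed
  obtain m where "CHAR('a) = Suc m"
    using finite_imp_CHAR_pos[where ?'a = 'a] by (auto simp: gr0_conv_Suc)
  then have "(0::'a) = of_nat (Suc m)" by (metis of_nat_CHAR)
  moreover have "- 1 - of_nat m = - (of_nat (Suc m) :: 'a)"
    by (simp only: of_nat_Suc minus_add_distrib diff_conv_add_uminus)
  ultimately have "- 1 - of_nat m = (0::'a)" by simp
  then show False using nonsq[of m] sq01(1) by metis
qed

text \<open>
  The two factors differ by a nonzero square factor, so \<open>a x = b y\<close> forces \<open>x\<close> and \<open>y\<close> to be
  both squares or both nonsquares.
\<close>

lemma bij_piecewise_mult:
  assumes "(a::'a::{field,finite}) \<noteq> 0" "is_square (b / a)" "b \<noteq> 0"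
  shows "bij (\<lambda>x. if is_square x then a * x else b * x)"
proof -
  obtain c where c: "b = a * c ^ 2" "c \<noteq> 0" using assms by (force simp: is_square_def field_simps)
  have sq: "is_square (c ^ 2 * x) \<longleftrightarrow> is_square x" for x
  proof
    assume "is_square (c ^ 2 * x)"
    then obtain y where "c ^ 2 * x = y ^ 2" by (auto simp: is_square_def)
    then have "x = (y / c) ^ 2" using c(2) by (simp add: field_simps)
    then show "is_square x" by (auto simp: is_square_def)
  next
    assume "is_square x"
    then obtain y where "x = y ^ 2" by (auto simp: is_square_def)
    then have "c ^ 2 * x = (c * y) ^ 2" by (simp add: power_mult_distrib)
    then show "is_square (c ^ 2 * x)" by (auto simp: is_square_def)
  qed
  have "inj (\<lambda>x. if is_square x then a * x else b * x)"
    by (rule injI) (use assms c sq in \<open>auto split: if_splits\<close>)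
  then show ?thesis by (intro bijI finite_UNIV_inj_surj) auto
qed

text \<open>
  The rotation \<open>(0 1 t)\<close> is a switch, with \<open>\<rho>\<close> its inverse, for every complete \<open>f\<close> with
  \<open>f 0 = 0\<close>, \<open>f 1 = t - 1\<close> and \<open>f t = -1\<close>. No multiplication need satisfy this, but
  multiplication by \<open>t - 1\<close> on the squares and by \<open>-1 / t\<close> on the nonsquares does when \<open>t\<close> is a
  nonsquare. The quotient of the two factors is a square, and so is that of \<open>t\<close> and \<open>1 - 1 / t\<close>,
  the factors of \<open>x + f x\<close>, provided that \<open>1 - t\<close> is a nonsquare too.
\<close>

lemma Alt_subset_P_comp_3_mod_4:
  assumes "card (UNIV :: 'a::{field,finite} set) mod 4 = 3" "card (UNIV :: 'a set) \<ge> 4"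
  shows "(Alt :: ('a \<Rightarrow> 'a) set) \<subseteq> P_comp"
proof -
  obtain t :: 'a where t: "\<not> is_square t" "\<not> is_square (1 - t)"
    using two_nonsquares_sum_one[OF assms(1)] by blast
  have sq: "is_square (y ^ 2)" for y :: 'a by (auto simp: is_square_def)
  have sq01: "is_square (0::'a)" "is_square (1::'a)" using sq[of 0] sq[of 1] by auto
  have d: "t \<noteq> 0" "t \<noteq> 1" using t sq01 by auto
  define f where "f = (\<lambda>x. if is_square x then (t - 1) * x else - x / t)"
  have "complete_mapping f"
  proof -
    obtain y where y: "t * (1 - t) = y ^ 2"
      using nonsquare_mult_nonsquare[OF t] by (auto simp: is_square_def)
    have "t * (1 - t) = - (t * (t - 1))" by (simp add: algebra_simps)
    then have "(- 1 / t) / (t - 1) = 1 / (t * (1 - t))" by simp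
    also have "\<dots> = (1 / y) ^ 2" by (simp only: y power_one_over)
    finally have "is_square ((- 1 / t) / (t - 1))" by (simp only: sq)
    then have "bij (\<lambda>x. if is_square x then (t - 1) * x else - 1 / t * x)"
      using d by (intro bij_piecewise_mult) auto
    also have "(\<lambda>x. if is_square x then (t - 1) * x else - 1 / t * x) = f" by (auto simp: f_def)
    finally have 1: "bij f" .
    have "is_square ((-1) * (1 - t))"
      using nonsquare_mult_nonsquare[OF minus_one_nonsquare[OF assms(1)] t(2)] .
    then obtain y where "t - 1 = y ^ 2" by (auto simp: is_square_def)
    then have "((t - 1) / t) / t = (y / t) ^ 2" by (simp add: power2_eq_square)
    then have "bij (\<lambda>x. if is_square x then t * x else (t - 1) / t * x)"
      using d sq by (intro bij_piecewise_mult) auto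
    also have "(\<lambda>x. if is_square x then t * x else (t - 1) / t * x) = (\<lambda>x. x + f x)"
      using d by (auto simp: f_def field_simps)
    finally show ?thesis using 1 by (simp add: complete_mapping_def)
  qed
  moreover have dist: "distinct [0, 1, t]" "distinct [0, t, 1]" using d by auto
  have "x + f (cycle_of_list [0, 1, t] x) = cycle_of_list [0, t, 1] x + f (cycle_of_list [0, t, 1] x)" for x
  proof (cases "x \<in> {0, 1, t}")
    case True
    have "f 0 = 0" "f 1 = t - 1" "f t = -1" using sq01 t(1) d by (auto simp: f_def)
    then show ?thesis
      using True cycle3_simps[OF dist(1)] cycle3_simps[OF dist(2)] by auto
  next
    case False
    then show ?thesis using cycle3_outside[of x] by simp
  qed
  ultimately have "cycle_of_list [0, 1, t] \<in> P_comp"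
    by (intro switch_in_P_comp[of f _ "cycle_of_list [0, t, 1]"] permutation_bijective permutation_of_cycle)
  then show ?thesis
    using Alt_subset_if_3cycle_and_affine[OF subgroup_P_comp affine_in_P_comp dist(1)] assms(2) by blast
qed

lemma P_comp_odd:
  assumes "odd (card (UNIV :: 'a::{field,finite} set))" "card (UNIV :: 'a set) \<ge> 7"
  shows "(P_comp :: ('a \<Rightarrow> 'a) set) = carrier SymGroup"
proof -
  have "n mod 4 = 3 \<or> n mod 4 = 1 \<and> n \<ge> 9" if "odd n" "n \<ge> 7" for n :: nat using that by presburger
  from this[OF assms] have "(Alt :: ('a \<Rightarrow> 'a) set) \<subseteq> P_comp"
    using Alt_subset_P_comp_1_mod_4[where ?'a = 'a] Alt_subset_P_comp_3_mod_4[where ?'a = 'a] assms(2) by linarith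
  moreover obtain g :: 'a where "g \<noteq> 0" "\<not> evenperm (\<lambda>x. g * x)" using odd_permutation_mult[OF assms(1)] by blast
  ultimately show ?thesis
    using Sym_if_Alt_and_odd[OF subgroup_P_comp] affine_in_P_comp[of g 0] assms(2) by auto
qed

section \<open>Fields of characteristic 2\<close>

lemma char_2_if_card_power_of_2:
  assumes "card (UNIV :: 'a::{field,finite} set) = 2 ^ k"
  shows "(x::'a::{field,finite}) + x = 0"
proof -
  have "(of_nat (2 ^ k) :: 'a) = 0"
    using CHAR_dvd_CARD[where ?'a = 'a] assms by (simp only: of_nat_eq_0_iff_char_dvd)
  then have "(2::'a) = 0" by simp
  then show ?thesis using mult_2[of x] by simp
qed

text \<open>
  In characteristic 2 a predicate \<open>P\<close> with periods \<open>u\<close> and \<open>a u\<close> describes a union of cosets of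
  \<open>{0, u, a u, u + a u}\<close>. On these cosets multiplication by \<open>a\<close> can be switched: shifting the
  argument by \<open>u + a u\<close> has the same effect on the sums \<open>x + a x\<close> as the permutation that shifts
  by \<open>a u\<close>. For a single coset this gives complete mappings that are far from additive, for a
  union forming the complement of an additive subgroup it gives transvections.
\<close>

lemma coset_switch:
  fixes a u :: "'a::{field,finite}"
  assumes two: "\<And>x::'a. x + x = 0" and a: "a \<noteq> 0" "a \<noteq> 1"
    and P: "\<And>x. P (x + u) = P x" "\<And>x. P (x + a * u) = P x"
  defines "\<pi> \<equiv> (\<lambda>x. if P x then x + u + a * u else x)"
  shows "complete_mapping ((\<lambda>x. a * x) \<circ> \<pi>)" "\<pi> \<in> P_comp"
proof -
  define \<rho> where "\<rho> = (\<lambda>x. if P x then x + a * u else x)"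
  have two': "x + (x + y) = y" for x y :: 'a using two by (simp add: add.assoc[symmetric])
  have P2: "P (x + (u + a * u)) = P x" for x using P by (simp add: add.assoc[symmetric])
  have "bij \<pi>"
    by (rule involuntory_imp_bij) (auto simp: \<pi>_def P2 ac_simps two two')
  moreover have "bij \<rho>"
    by (rule involuntory_imp_bij) (auto simp: \<rho>_def P ac_simps two two')
  moreover have "x + a * \<pi> x = \<rho> x + a * \<rho> x" for x
    by (auto simp: \<pi>_def \<rho>_def algebra_simps)
  moreover have "- 1 = (1::'a)" using two by (rule minus_unique)
  then have "a \<noteq> - 1" using a(2) by (simp only: not_False_eq_True)
  then have "complete_mapping (\<lambda>x. a * x)"
    using complete_mapping_affine[OF a(1), of 0] by simp
  ultimately show "complete_mapping ((\<lambda>x. a * x) \<circ> \<pi>)" "\<pi> \<in> P_comp"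
    using complete_mapping_switch[of "\<lambda>x. a * x" \<pi> \<rho>] switch_in_P_comp[of "\<lambda>x. a * x" \<pi> \<rho>] by auto
qed

text \<open>
  The five polynomials are those with roots \<open>0\<close>, \<open>1\<close>, the remaining elements of the field with
  four elements, and the remaining elements of the field with eight elements; in total they have
  at most ten roots.
\<close>

lemma element_outside_F4_F8:
  assumes "card (UNIV :: 'a::{field,finite} set) > 10"
  obtains a :: "'a::{field,finite}" where "a \<noteq> 0" "a + 1 \<noteq> 0" "a ^ 2 + a + 1 \<noteq> 0"
    "a ^ 3 + a + 1 \<noteq> 0" "a ^ 3 + a ^ 2 + 1 \<noteq> 0"
proof -
  define p :: "'a poly" where
    "p = [:0, 1:] * ([:1, 1:] * ([:1, 1, 1:] * ([:1, 1, 0, 1:] * [:1, 0, 1, 1:])))"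
  have "degree p = 10" unfolding p_def by (subst degree_mult_eq, simp, simp)+ simp
  moreover from this have "p \<noteq> 0" by auto
  ultimately have "card {x. poly p x = 0} \<le> 10" using card_poly_roots_bound[of p] by simp
  then have "{x. poly p x = 0} \<noteq> UNIV" using assms by auto
  then obtain a where "poly p a \<noteq> 0" by auto
  then have "poly [:0, 1:] a \<noteq> 0" "poly [:1, 1:] a \<noteq> 0" "poly [:1, 1, 1:] a \<noteq> 0"
    "poly [:1, 1, 0, 1:] a \<noteq> 0" "poly [:1, 0, 1, 1:] a \<noteq> 0"
    by (auto simp only: p_def poly_mult mult_eq_0_iff)
  then show ?thesis
    by (intro that[of a]) (simp_all add: algebra_simps power2_eq_square power3_eq_cube)
qed

text \<open>
  All permutations that are affine over the field with two elements are even here, so an odd one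
  has to come from complete mappings that are not affine in this sense. Multiplication by \<open>a\<close> is
  therefore first switched on the coset of \<open>{0, a\<^sup>2, a\<^sup>3, a\<^sup>2 + a\<^sup>3}\<close> that contains \<open>a\<close>. Of the
  four points \<open>0\<close>, \<open>a + 1\<close>, \<open>a\<^sup>3 + a\<close>, \<open>a\<^sup>2 + 1\<close> only the third lies in this coset, and the
  resulting complete mapping \<open>f\<close> has the values there that admit the rotation of the four points
  as a second switch, \<open>\<rho>\<close> being the square of the rotation. This puts a 4-cycle into the group,
  which is odd and of small support at once. Choosing \<open>a\<close> outside the fields with four and eight
  elements keeps the points distinct and the other three outside the coset.
\<close>

lemma P_comp_even:
  assumes "card (UNIV :: 'a::{field,finite} set) = 2 ^ k" "card (UNIV :: 'a set) > 10"
  shows "(P_comp :: ('a \<Rightarrow> 'a) set) = carrier SymGroup"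
proof -
  have two: "x + x = 0" for x :: 'a using char_2_if_card_power_of_2[OF assms(1)] .
  have two': "x + (x + y) = y" for x y :: 'a using two by (simp add: add.assoc[symmetric])
  obtain a :: 'a where n: "a \<noteq> 0" "a + 1 \<noteq> 0" "a ^ 2 + a + 1 \<noteq> 0"
    "a ^ 3 + a + 1 \<noteq> 0" "a ^ 3 + a ^ 2 + 1 \<noteq> 0"
    using element_outside_F4_F8[OF assms(2)] by blast
  \<comment> \<open>every coincidence excluded below is the vanishing of one of these products or of a factor\<close>
  have "a * (a + 1) \<noteq> 0" "a * (a + 1) * (a + 1) \<noteq> 0" "a * (a ^ 2 + a + 1) \<noteq> 0"
    "(a + 1) * (a + 1) \<noteq> 0" "(a + 1) * (a ^ 2 + a + 1) \<noteq> 0" "(a + 1) * (a + 1) * (a + 1) \<noteq> 0"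
    using n by auto
  then have m: "a + a ^ 2 \<noteq> 0" "a + a ^ 3 \<noteq> 0" "a + (a ^ 2 + a ^ 3) \<noteq> 0"
    "1 + a ^ 2 \<noteq> 0" "1 + a ^ 3 \<noteq> 0" "1 + (a + (a ^ 2 + a ^ 3)) \<noteq> 0"
    by (auto simp: algebra_simps power2_eq_square power3_eq_cube two two')
  have n': "1 + a \<noteq> 0" "1 + (a + a ^ 2) \<noteq> 0" "1 + (a + a ^ 3) \<noteq> 0" "1 + (a ^ 2 + a ^ 3) \<noteq> 0"
    using n by (simp_all add: ac_simps)
  define P where "P x \<longleftrightarrow> x + a = 0 \<or> x + a + a ^ 2 = 0 \<or> x + a + a ^ 3 = 0 \<or> x + a + a ^ 2 + a ^ 3 = 0" for x
  define \<pi> where "\<pi> x = (if P x then x + a ^ 2 + a * a ^ 2 else x)" for x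
  define f where "f = (\<lambda>x. a * x) \<circ> \<pi>"
  have "a * a ^ 2 = a ^ 3" by (simp add: power2_eq_square power3_eq_cube)
  have sh: "P (x + a ^ 2) = P x" "P (x + a * a ^ 2) = P x" for x
    unfolding \<open>a * a ^ 2 = a ^ 3\<close> P_def by (auto simp: ac_simps two two')
  have "a \<noteq> 1" using n'(1) two[of 1] by auto
  then have f: "complete_mapping f"
    unfolding f_def \<pi>_def using n(1) sh two by (intro coset_switch(1)) auto
  define x2 x3 x4 where x: "x2 = a + 1" "x3 = a ^ 3 + a" "x4 = a ^ 2 + 1"
  \<comment> \<open>of the four points, only \<open>x3\<close> lies in the switched coset\<close>
  have "\<not> P 0" "\<not> P x2" "\<not> P x4" "P x3"
    using n(1) m n' unfolding P_def x by (simp_all add: ac_simps two two')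
  then have fx: "f 0 = 0" "f x2 = a ^ 2 + a" "f x3 = a ^ 2 + a ^ 3" "f x4 = a ^ 3 + a"
    unfolding f_def by (simp_all add: \<pi>_def x algebra_simps power2_eq_square power3_eq_cube two two')
  have "x2 \<noteq> 0" "x3 \<noteq> 0" "x4 \<noteq> 0" "x2 + x3 \<noteq> 0" "x2 + x4 \<noteq> 0" "x3 + x4 \<noteq> 0"
    using n m n' unfolding x by (simp_all add: ac_simps two two')
  then have d: "distinct [0, x2, x3, x4]" using two by auto
  define \<sigma> where "\<sigma> = cycle_of_list [0, x2, x3, x4]"
  define \<rho> where "\<rho> = transpose 0 x3 \<circ> transpose x2 x4"
  have \<sigma>x: "\<sigma> 0 = x2" "\<sigma> x2 = x3" "\<sigma> x3 = x4" "\<sigma> x4 = 0"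
    and \<rho>x: "\<rho> 0 = x3" "\<rho> x2 = x4" "\<rho> x3 = 0" "\<rho> x4 = x2"
    using d by (auto simp: \<sigma>_def \<rho>_def transpose_def)
  have \<sigma>: "\<sigma> \<in> P_comp"
  proof (rule switch_in_P_comp[OF f])
    show "bij \<sigma>" "bij \<rho>" unfolding \<sigma>_def \<rho>_def
      by (intro bij_comp permutation_bijective permutation_swap_id permutation_of_cycle)+
    fix y
    show "y + f (\<sigma> y) = \<rho> y + f (\<rho> y)"
    proof (cases "y \<in> {0, x2, x3, x4}")
      case True
      then consider "y = 0" | "y = x2" | "y = x3" | "y = x4" by blast
      then show ?thesis
        by cases (simp_all only: \<sigma>x \<rho>x fx, simp_all add: x ac_simps two two')
    next
      case False
      then have "\<sigma> y = y" "\<rho> y = y"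
        unfolding \<sigma>_def \<rho>_def using id_outside_supp[of y "[0, x2, x3, x4]"] by (auto simp: transpose_def)
      then show ?thesis by simp
    qed
  qed
  have "(Alt :: ('a \<Rightarrow> 'a) set) \<subseteq> P_comp"
  proof (rule Alt_subset_P_comp_if_small_support[OF \<sigma>])
    show "\<sigma> \<noteq> id" using \<sigma>x(1) d by auto
    show "{y. \<sigma> y \<noteq> y} \<subseteq> {0, x2, x3, x4}"
      using id_outside_supp[of _ "[0, x2, x3, x4]"] by (auto simp only: \<sigma>_def list.set)
    show "card {0, x2, x3, x4} \<le> 4" by (simp add: card_insert_if)
  qed (use assms(2) in simp)
  moreover have "\<not> evenperm \<sigma>" unfolding \<sigma>_def by (subst evenperm_cycle_of_list[OF d]) simp_all
  ultimately show ?thesis using Sym_if_Alt_and_odd[OF subgroup_P_comp _ \<sigma>] by blast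
qed

section \<open>Transvections in characteristic 2\<close>

lemma closed_coset_union:
  fixes H :: "'a::ab_group_add set"
  assumes two: "\<And>x::'a. x + x = 0" and H: "\<And>x y. x \<in> H \<Longrightarrow> y \<in> H \<Longrightarrow> x + y \<in> H"
    and "y \<in> H \<union> (\<lambda>h. h + x) ` H" "z \<in> H \<union> (\<lambda>h. h + x) ` H"
  shows "y + z \<in> H \<union> (\<lambda>h. h + x) ` H"
proof -
  have "\<exists>h a. h \<in> H \<and> w = h + a \<and> (a = 0 \<or> a = x)" if w: "w \<in> H \<union> (\<lambda>h. h + x) ` H" for w
    using w
  proof
    assume "w \<in> H"
    then show ?thesis by (intro exI[of _ w] exI[of _ 0]) simp
  next
    assume "w \<in> (\<lambda>h. h + x) ` H"
    then show ?thesis by blast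
  qed
  then obtain h a k b where "h \<in> H" "y = h + a" "a = 0 \<or> a = x" "k \<in> H" "z = k + b" "b = 0 \<or> b = x"
    using assms(3,4) by metis
  then have "y + z = (h + k) + (a + b)" "a + b = 0 \<or> a + b = x" "h + k \<in> H"
    using two H by (auto simp: ac_simps)
  then show ?thesis by auto
qed

text \<open>
  A subgroup that is maximal among those avoiding \<open>v\<close> has index 2: adjoining any \<open>x\<close> outside it
  must bring in \<open>v\<close>, that is, \<open>x + v\<close> was already inside. In characteristic 2, where closure
  under addition suffices for a subgroup, this replaces extending a linear functional over the
  field with two elements.
\<close>

lemma maximal_subgroup_avoiding:
  fixes U :: "'a::{ab_group_add,finite} set"
  assumes two: "\<And>x::'a. x + x = 0"
    and U: "0 \<in> U" "\<And>x y. x \<in> U \<Longrightarrow> y \<in> U \<Longrightarrow> x + y \<in> U" "v \<notin> U"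
  obtains H where "U \<subseteq> H" "\<And>x y. x \<in> H \<Longrightarrow> y \<in> H \<Longrightarrow> x + y \<in> H"
    "v \<notin> H" "\<And>x. x \<notin> H \<Longrightarrow> x + v \<in> H"
proof -
  define F where "F = {H. U \<subseteq> H \<and> (\<forall>x\<in>H. \<forall>y\<in>H. x + y \<in> H) \<and> v \<notin> H}"
  have "U \<in> F" using U by (auto simp: F_def)
  then have "F \<noteq> {}" by blast
  from finite_has_maximal[OF finite this]
  obtain H where "H \<in> F" and max: "\<forall>K\<in>F. H \<subseteq> K \<longrightarrow> H = K" by blast
  then have H: "U \<subseteq> H" "\<And>x y. x \<in> H \<Longrightarrow> y \<in> H \<Longrightarrow> x + y \<in> H" "v \<notin> H"
    by (auto simp: F_def)
  have two': "x + (x + y) = y" "y + x + x = y" for x y :: 'a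
    using two by (simp add: add.assoc[symmetric], simp add: add.assoc)
  have "x + v \<in> H" if "x \<notin> H" for x
  proof -
    \<comment> \<open>the subgroup generated by \<open>H\<close> and \<open>x\<close>\<close>
    define K where "K = H \<union> (\<lambda>h. h + x) ` H"
    have "0 \<in> H" using H(1) U(1) by blast
    then have "x \<in> K" unfolding K_def by force
    moreover have sub: "H \<subseteq> K" by (simp add: K_def)
    ultimately have "K \<notin> F" using max that by blast
    moreover have "\<forall>y\<in>K. \<forall>z\<in>K. y + z \<in> K"
      unfolding K_def by (intro ballI closed_coset_union two H(2))
    ultimately have "v \<in> K" using sub H(1) by (auto simp: F_def)
    then obtain h where "h \<in> H" "v = h + x" using H(3) by (auto simp: K_def)
    then show ?thesis using two' by (simp add: ac_simps)
  qed
  then show ?thesis using that[of H] H by auto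
qed

text \<open>
  The subgroup \<open>H\<close> has at least four elements, so it contains some \<open>u\<close> other than \<open>0\<close> and \<open>h\<close>.
  With \<open>a = (u + h) / u\<close> the shift \<open>u + a u\<close> equals \<open>h\<close>, and both \<open>u\<close> and \<open>a u\<close> are periods of
  the complement of \<open>H\<close>; the transvection is the coset switch for these data.
\<close>

lemma transvection_in_P_comp:
  fixes h :: "'a::{field,finite}"
  assumes two: "\<And>x::'a. x + x = 0" and q: "card (UNIV :: 'a set) \<ge> 8"
    and H: "\<And>x y. x \<in> H \<Longrightarrow> y \<in> H \<Longrightarrow> x + y \<in> H" "\<And>x. x \<notin> H \<Longrightarrow> x + v \<in> H"
    and h: "h \<in> H" "h \<noteq> 0"
  shows "(\<lambda>x. if x \<in> H then x else x + h) \<in> P_comp"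
proof -
  have two': "x + (x + y) = y" for x y :: 'a
    using two by (simp add: add.assoc[symmetric])
  have "x = (x + v) + v" for x :: 'a using two by (simp add: add.assoc)
  then have "UNIV = H \<union> (\<lambda>x. x + v) ` H" using H(2) by blast
  then have "8 \<le> card (H \<union> (\<lambda>x. x + v) ` H)" using q by simp
  also have "\<dots> \<le> card H + card H"
    by (rule order_trans[OF card_Un_le]) (simp add: card_image_le)
  finally have "card H \<ge> 4" by simp
  moreover have "card {0, h} \<le> 2" by (simp add: card_insert_if)
  ultimately have "\<not> H \<subseteq> {0, h}" using card_mono[of "{0, h}" H] by auto
  then obtain u where u: "u \<in> H" "u \<noteq> 0" "u \<noteq> h" by blast
  define a where "a = (u + h) / u"
  have au: "a * u = u + h" using u by (simp add: a_def)
  have "u + h \<noteq> 0" using u two' by (metis add_0_right)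
  then have a: "a \<noteq> 0" "a \<noteq> 1" using au u h by auto
  have sh: "(x + k \<notin> H) = (x \<notin> H)" if "k \<in> H" for x k
    using H(1)[OF that, of x] H(1)[OF that, of "x + k"] two' by (auto simp: ac_simps)
  have "(\<lambda>x. if x \<notin> H then x + u + a * u else x) \<in> P_comp"
    using coset_switch(2)[of a "\<lambda>x. x \<notin> H" u, OF two a] sh u(1) H(1)[OF u(1) h(1)] au by simp
  also have "(\<lambda>x. if x \<notin> H then x + u + a * u else x) = (\<lambda>x. if x \<in> H then x else x + h)"
    using two' by (auto simp: au add.assoc)
  finally show ?thesis .
qed

text \<open>
  Transvections generate the linear group over the field with two elements: if \<open>A\<close> moves \<open>v\<close>, a
  transvection in direction \<open>v + A v\<close> that is the identity on the fixed points of \<open>A\<close> takes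
  \<open>A v\<close> back to \<open>v\<close> and so enlarges the set of fixed points.
\<close>

lemma additive_bij_in_P_comp:
  fixes A :: "'a::{field,finite} \<Rightarrow> 'a"
  assumes two: "\<And>x::'a. x + x = 0" and q: "card (UNIV :: 'a set) \<ge> 8"
    and "bij A" "\<And>x y. A (x + y) = A x + A y"
  shows "A \<in> P_comp"
  using assms(3,4)
proof (induction "card (UNIV :: 'a set) - card {x. A x = x}" arbitrary: A rule: less_induct)
  case less
  have two': "x + (x + y) = y" "x + y + y = x" for x y :: 'a
    using two by (simp add: add.assoc[symmetric], simp add: add.assoc)
  let ?U = "{x. A x = x}"
  show ?case
  proof (cases "?U = UNIV")
    case True
    then have "A = id" by (auto simp: fun_eq_iff)
    then show ?thesis using subgroup_SymGroupD(2)[OF subgroup_P_comp] by simp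
  next
    case False
    then obtain v where v: "A v \<noteq> v" by auto
    define h where "h = v + A v"
    have A0: "A 0 = 0" using less.prems(2)[of 0 0] by (metis add_cancel_left_left)
    have "A (A v) \<noteq> A v" using v less.prems(1) by (meson bij_is_inj injD)
    \<comment> \<open>\<open>v\<close> is not in the subgroup generated by the fixed points and \<open>h\<close>, as \<open>A v\<close> is not a fixed point\<close>
    define U where "U = ?U \<union> (\<lambda>x. x + h) ` ?U"
    have "v \<notin> U"
    proof
      assume "v \<in> U"
      then obtain u where "A u = u" "v = u + h" using v by (auto simp: U_def)
      then have "u = A v" using two' by (metis h_def add.commute)
      then show False using \<open>A u = u\<close> \<open>A (A v) \<noteq> A v\<close> by simp
    qed
    moreover have "x + y \<in> U" if "x \<in> U" "y \<in> U" for x y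
      using that unfolding U_def by (intro closed_coset_union two) (use less.prems(2) in simp_all)
    moreover have "0 \<in> U" using A0 by (simp add: U_def)
    ultimately obtain H where H: "U \<subseteq> H" "\<And>x y. x \<in> H \<Longrightarrow> y \<in> H \<Longrightarrow> x + y \<in> H"
      "v \<notin> H" "\<And>x. x \<notin> H \<Longrightarrow> x + v \<in> H"
      using maximal_subgroup_avoiding[OF two, of U v] by blast
    have "0 + h \<in> U" unfolding U_def using A0 by blast
    then have "h \<in> H" using H(1) by auto
    moreover have "v + h = A v" unfolding h_def by (rule two')
    then have "h \<noteq> 0" using v by auto
    ultimately have h: "h \<in> H" "h \<noteq> 0" by blast+
    define T where "T = (\<lambda>x. if x \<in> H then x else x + h)"
    have T: "T \<in> P_comp" unfolding T_def by (rule transvection_in_P_comp[OF two q H(2) H(4) h])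
    have hH: "x + h \<in> H \<longleftrightarrow> x \<in> H" for x using H(2)[OF _ h(1)] two' by metis
    have TT: "T (T x) = x" for x using hH two' by (simp add: T_def)
    have T_add: "T (x + y) = T x + T y" for x y
    proof -
      have "x + y \<in> H" if "x \<notin> H" "y \<notin> H"
      proof -
        have "(x + v) + (y + v) = x + y + (v + v)" by (simp only: ac_simps)
        then show ?thesis
          using H(2)[OF H(4)[OF that(1)] H(4)[OF that(2)]] by (simp only: two add_0_right)
      qed
      moreover have "x \<in> H" if "x + y \<in> H" "y \<in> H" using H(2)[OF that] two' by simp
      moreover have "y \<in> H" if "x + y \<in> H" "x \<in> H" using H(2)[OF that(2,1)] two' by simp
      ultimately have iff: "x + y \<in> H \<longleftrightarrow> (x \<in> H \<longleftrightarrow> y \<in> H)" using H(2) by blast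
      have "(x + h) + (y + h) = x + y + (h + h)" by (simp only: ac_simps)
      then have "(x + h) + (y + h) = x + y" by (simp only: two add_0_right)
      then show ?thesis by (cases "x \<in> H"; cases "y \<in> H") (simp_all add: T_def iff ac_simps)
    qed
    have fix_U: "T x = x" if "A x = x" for x using that H(1) by (auto simp: T_def U_def)
    have "A v \<notin> H"
    proof
      assume "A v \<in> H"
      then have "A v + h \<in> H" using hH by blast
      moreover have "A v + h = v" unfolding h_def by (subst add.commute) (rule two')
      ultimately show False using H(3) by simp
    qed
    then have Tv: "T (A v) = v" using two' by (simp add: T_def h_def ac_simps)
    have "card {x. (T \<circ> A) x = x} > card ?U"
      by (rule psubset_card_mono) (use fix_U Tv v in auto)
    moreover have "card {x. (T \<circ> A) x = x} \<le> card (UNIV :: 'a set)" by (rule card_mono) auto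
    ultimately have "card (UNIV :: 'a set) - card {x. (T \<circ> A) x = x} < card (UNIV :: 'a set) - card ?U"
      by linarith
    moreover have "bij (T \<circ> A)"
      using less.prems(1) subgroup_SymGroupD(1)[OF subgroup_P_comp T] by (rule bij_comp)
    moreover have "(T \<circ> A) (x + y) = (T \<circ> A) x + (T \<circ> A) y" for x y
      by (simp add: less.prems(2) T_add)
    ultimately have "T \<circ> A \<in> P_comp" by (rule less.hyps)
    then have "T \<circ> (T \<circ> A) \<in> P_comp" using T subgroup_SymGroupD(3)[OF subgroup_P_comp] by blast
    moreover have "T \<circ> (T \<circ> A) = A" using TT by auto
    ultimately show ?thesis by simp
  qed
qed

section \<open>Affine groups and primitivity\<close>

lemma additive_of_nat_mult:
  fixes A :: "'a::field \<Rightarrow> 'a"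
  assumes "\<And>x y. A (x + y) = A x + A y"
  shows "A (of_nat n * x) = of_nat n * A x"
proof (induction n)
  case 0
  then show ?case using assms[of 0 0] by (metis add_cancel_left_left mult_zero_left of_nat_0)
qed (simp add: assms distrib_right)

text \<open>
  Additivity entails linearity over the prime subfield.
\<close>

lemma AGL_iff:
  "f \<in> AGL \<longleftrightarrow> (\<exists>A b. bij A \<and> (\<forall>x y. A (x + y) = A x + A y) \<and> f = (\<lambda>x. A x + b))"
proof -
  have "A (c * x) = c * A x"
    if "\<forall>x y. A (x + y) = A x + A y" "c \<in> prime_subfield" for A :: "'a \<Rightarrow> 'a" and c x
    using that additive_of_nat_mult[of A] by (auto simp: prime_subfield_def)
  then show ?thesis unfolding AGL_def by blast
qed

lemma subgroup_AGL: "subgroup (AGL :: ('a::{field,finite} \<Rightarrow> 'a) set) SymGroup"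
  unfolding subgroup_SymGroup_iff
proof (intro conjI ballI)
  have add: "bij (\<lambda>x. x + b)" for b :: 'a using bij_affine[of 1 b] by simp
  show "id \<in> (AGL :: ('a \<Rightarrow> 'a) set)"
    unfolding AGL_iff by (intro exI[of _ id] exI[of _ 0]) auto
  fix f :: "'a \<Rightarrow> 'a" assume "f \<in> AGL"
  then obtain A b where A: "bij A" "\<And>x y. A (x + y) = A x + A y" "f = (\<lambda>x. A x + b)"
    unfolding AGL_iff by auto
  show bf: "bij f" using bij_comp[OF A(1) add[of b]] by (simp add: A(3) o_def)
  show "f \<circ> g \<in> AGL" if g: "g \<in> AGL" for g
  proof -
    obtain B c where B: "bij B" "\<And>x y. B (x + y) = B x + B y" "g = (\<lambda>x. B x + c)"
      using g unfolding AGL_iff by auto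
    show ?thesis
      unfolding AGL_iff
      by (intro exI[of _ "A \<circ> B"] exI[of _ "A c + b"]) (auto simp: A B bij_comp add.assoc)
  qed
  let ?B = "inv' A"
  have AB: "A (?B x) = x" for x using A(1) by (simp add: bij_is_surj surj_f_inv_f)
  have B_add: "?B (x + y) = ?B x + ?B y" for x y
    by (rule injD[OF bij_is_inj[OF A(1)]]) (simp add: A(2) AB)
  have "f (?B x + ?B (- b)) = x" for x by (simp add: A(2,3) AB)
  then have "inv' f = (\<lambda>x. ?B x + ?B (- b))"
    by (intro ext inv_f_eq[OF bij_is_inj[OF bf]])
  then show "inv' f \<in> AGL"
    unfolding AGL_iff using B_add bij_imp_bij_inv[OF A(1)] by blast
qed

text \<open>
  If \<open>g\<close> maps \<open>x\<close> to \<open>x\<close> or \<open>y\<close>, then it cannot move a block containing both \<open>x\<close> and \<open>y\<close> off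
  itself, so the block contains \<open>g y\<close> as well. The hypothesis has two sources: a 2-transitive
  group offers \<open>g x = x\<close>, a 3-cycle \<open>g x = y\<close>.
\<close>

lemma primitive_if_moves:
  fixes S :: "('a \<Rightarrow> 'a) set"
  assumes S: "subgroup S SymGroup"
    and trans: "\<And>x y. \<exists>g\<in>S. g x = y"
    and move: "\<And>x y z. distinct [x, y, z] \<Longrightarrow> \<exists>g\<in>S. g x \<in> {x, y} \<and> g y = z"
  shows "primitive_perm_group S UNIV"
proof -
  have "group_hom (SymGroup\<lparr>carrier := S\<rparr>) SymGroup (\<lambda>g. g)"
    using S subgroup.subset[OF S]
    by (intro group_hom.intro group_hom_axioms.intro)
      (auto simp: group_BijGroup hom_def subgroup.subgroup_is_group)
  then have "transitive_action (SymGroup\<lparr>carrier := S\<rparr>) UNIV (\<lambda>g. g)"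
    using trans by (intro transitive_action.intro group_action.intro transitive_action_axioms.intro) auto
  moreover have "B = UNIV \<or> (\<exists>x. B = {x})"
    if B: "B \<noteq> {}" "\<forall>g\<in>S. g ` B = B \<or> g ` B \<inter> B = {}" for B
  proof (cases "\<exists>x. B = {x}")
    case False
    then obtain x y where xy: "x \<in> B" "y \<in> B" "x \<noteq> y" using B(1) by blast
    have "z \<in> B" for z
    proof (cases "z = x \<or> z = y")
      case False
      then obtain g where g: "g \<in> S" "g x \<in> {x, y}" "g y = z" using move[of x y z] xy(3) by auto
      then have "g x \<in> g ` B \<inter> B" using xy by auto
      then have "g ` B = B" using B(2) g(1) by blast
      then show ?thesis using g(3) xy(2) by blast
    qed (use xy in auto)
    then show ?thesis by blast
  qed simp
  ultimately show ?thesis using S by (simp add: primitive_perm_group_def)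
qed

lemma primitive_if_3cycles:
  fixes S :: "('a::finite \<Rightarrow> 'a) set"
  assumes S: "subgroup S SymGroup" and "Alt \<subseteq> S" and "card (UNIV :: 'a set) \<ge> 3"
  shows "primitive_perm_group S UNIV"
proof (rule primitive_if_moves[OF S])
  have cyc: "cycle_of_list [x, y, z] \<in> S" if "distinct [x, y, z]" for x y z
  proof -
    have "evenperm (cycle_of_list [x, y, z])" by (subst evenperm_cycle_of_list[OF that]) simp_all
    then show ?thesis
      using assms(2) permutation_bijective[OF permutation_of_cycle]
      by (auto simp only: Alt_def carrier_SymGroup)
  qed
  show "\<exists>g\<in>S. g x \<in> {x, y} \<and> g y = z" if "distinct [x, y, z]" for x y z
    using cyc[OF that] cycle3_simps[OF that] by blast
  show "\<exists>g\<in>S. g x = y" for x y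
  proof (cases "x = y")
    case True
    then show ?thesis using subgroup_SymGroupD(2)[OF S] by (metis id_apply)
  next
    case False
    have "card {x, y} \<le> 2" by (simp add: card_insert_if)
    then have "{x, y} \<noteq> UNIV" using assms(3) by auto
    then obtain z where "z \<notin> {x, y}" by blast
    then have "distinct [x, y, z]" using False by auto
    then show ?thesis using cyc[of x y z] cycle3_simps[of x y z] by blast
  qed
qed

lemma primitive_if_affine:
  fixes S :: "('a::{field,finite} \<Rightarrow> 'a) set"
  assumes S: "subgroup S SymGroup" and aff: "\<And>a b. a \<noteq> 0 \<Longrightarrow> (\<lambda>x. a * x + b) \<in> S"
  shows "primitive_perm_group S UNIV"
proof (rule primitive_if_moves[OF S])
  show "\<exists>g\<in>S. g x = y" for x y
    using aff[of 1 "y - x"] by (intro bexI[of _ "\<lambda>z. 1 * z + (y - x)"]) auto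
  show "\<exists>g\<in>S. g x \<in> {x, y} \<and> g y = z" if "distinct [x, y, z]" for x y z
  proof -
    obtain u v where "u \<noteq> 0" "u * x + v = x" "u * y + v = z"
      using affine_two_point_transitive[of x y x z] \<open>distinct [x, y, z]\<close> by auto
    then show ?thesis using aff[of u v] by (intro bexI[of _ "\<lambda>z. u * z + v"]) auto
  qed
qed

section \<open>The fields with at most four elements\<close>

text \<open>
  Nonzero translations are conjugate under multiplications and hence of the same parity; with at
  least three elements each of them is a product of two others.
\<close>

lemma even_translation:
  assumes "card (UNIV :: 'a::{field,finite} set) \<ge> 3"
  shows "evenperm (\<lambda>x. x + (b::'a::{field,finite}))"
proof -
  have perm: "permutation (\<lambda>x::'a. x + c)" "a \<noteq> 0 \<Longrightarrow> permutation (\<lambda>x::'a. a * x)" for a c :: 'a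
    using bij_affine[of 1 c] bij_affine[of a 0] by (simp_all add: permutation_finite)
  have scale: "evenperm (\<lambda>x. x + c) \<longleftrightarrow> evenperm (\<lambda>x. x + d)" if "c \<noteq> 0" "d \<noteq> 0" for c d :: 'a
  proof -
    define a where "a = d / c"
    have a: "a \<noteq> 0" "a * c = d" using that by (auto simp: a_def)
    have "(\<lambda>x. x + d) \<circ> (\<lambda>x. a * x) = (\<lambda>x. a * x) \<circ> (\<lambda>x. x + c)"
      using a by (auto simp: distrib_left)
    then have "(evenperm (\<lambda>x. x + d) \<longleftrightarrow> evenperm (\<lambda>x. a * x)) \<longleftrightarrow>
        (evenperm (\<lambda>x. a * x) \<longleftrightarrow> evenperm (\<lambda>x. x + c))"
      by (metis evenperm_comp[OF perm(1) perm(2)[OF a(1)]] evenperm_comp[OF perm(2)[OF a(1)] perm(1)])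
    then show ?thesis by blast
  qed
  show ?thesis
  proof (cases "b = 0")
    case False
    have "card {0, b} \<le> 2" by (simp add: card_insert_if)
    then have "{0, b} \<noteq> UNIV" using assms by auto
    then obtain c where c: "c \<noteq> 0" "c \<noteq> b" by blast
    have "(\<lambda>x. x + b) = (\<lambda>x. x + c) \<circ> (\<lambda>x. x + (b - c))" by auto
    then show ?thesis
      using scale[of c "b - c"] c evenperm_comp[OF perm(1)[of c] perm(1)[of "b - c"]] by simp
  qed simp
qed

lemma no_complete_mapping_2:
  assumes "card (UNIV :: 'a::{field,finite} set) = 2"
  shows "\<not> complete_mapping (f :: 'a::{field,finite} \<Rightarrow> 'a)"
proof
  assume "complete_mapping f"
  then have inj: "inj f" "inj (\<lambda>x. x + f x)" by (auto simp: complete_mapping_def bij_is_inj)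
  have "{0, 1} = (UNIV :: 'a set)" using assms by (intro card_subset_eq) auto
  then have ex: "x = 0 \<or> x = 1" for x :: 'a by auto
  have "f 0 \<noteq> f 1" "0 + f 0 \<noteq> 1 + f 1" using injD[OF inj(1), of 0 1] injD[OF inj(2), of 0 1] by auto
  moreover have "(1::'a) + 1 \<noteq> 1" by (simp only: add_cancel_left_right) simp
  then have "(1::'a) + 1 = 0" using ex[of "1 + 1"] by blast
  ultimately show False using ex[of "f 0"] ex[of "f 1"] by auto
qed

lemma P_trivial_2:
  assumes "card (UNIV :: 'a::{field,finite} set) = 2"
  shows "(P_comp :: ('a \<Rightarrow> 'a) set) = {id}" "(P_orth :: ('a \<Rightarrow> 'a) set) = {id}"
proof -
  have id: "subgroup {id :: 'a \<Rightarrow> 'a} SymGroup" by (auto simp: subgroup_SymGroup_iff)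
  have "(P_comp :: ('a \<Rightarrow> 'a) set) \<subseteq> {id}"
    using no_complete_mapping_2[OF assms] by (intro P_comp_subset[OF id]) auto
  then show "(P_comp :: ('a \<Rightarrow> 'a) set) = {id}"
    using subgroup_SymGroupD(2)[OF subgroup_P_comp] by blast
  have "(P_orth :: ('a \<Rightarrow> 'a) set) \<subseteq> {id}"
    using no_complete_mapping_2[OF assms] orthomorphism_iff_complete_uminus
    by (intro P_orth_subset[OF id]) auto
  then show "(P_orth :: ('a \<Rightarrow> 'a) set) = {id}"
    using subgroup_SymGroupD(2)[OF subgroup_P_orth] by blast
qed

lemma complete_mapping_3_is_translation:
  assumes "card (UNIV :: 'a::{field,finite} set) = 3" "complete_mapping (f :: 'a::{field,finite} \<Rightarrow> 'a)"
  shows "f = (\<lambda>x. x + f 0)"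
proof -
  have inj: "inj f" "inj (\<lambda>x. x + f x)" using assms(2) by (auto simp: complete_mapping_def bij_is_inj)
  have ne: "(1::'a) \<noteq> -1" using one_neq_minus_one_if_odd_card assms(1) by (metis odd_numeral)
  have U: "{c, c + 1, c - 1} = UNIV" for c :: 'a
  proof (rule card_subset_eq)
    have "c + 1 \<noteq> c - 1" using ne by (metis add_left_cancel add_uminus_conv_diff)
    then show "card {c, c + 1, c - 1} = card (UNIV :: 'a set)" using assms(1) by simp
  qed auto
  have "f 1 \<noteq> f 0" "f (-1) \<noteq> f 0" "f (-1) \<noteq> f 1"
    using ne injD[OF inj(1)] by (metis zero_neq_one neg_0_equal_iff_equal)+
  moreover have "1 + f 1 \<noteq> f 0" using injD[OF inj(2), of 1 0] by auto
  then have "f 1 \<noteq> f 0 - 1" by auto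
  ultimately have f1: "f 1 = f 0 + 1" using U[of "f 0"] by blast
  have fm1: "f (-1) = f 0 - 1"
    using U[of "f 0"] \<open>f (-1) \<noteq> f 0\<close> \<open>f (-1) \<noteq> f 1\<close> f1 by auto
  have "x = 0 \<or> x = 1 \<or> x = -1" for x :: 'a using U[of 0] by auto
  moreover have "f x = x + f 0" if "x = 0 \<or> x = 1 \<or> x = -1" for x
    using that by (elim disjE) (simp_all add: f1 fm1)
  ultimately have "f x = x + f 0" for x by blast
  then show ?thesis by (rule ext)
qed

lemma Alt_subset_if_translations_3:
  fixes S :: "('a::{field,finite} \<Rightarrow> 'a) set"
  assumes q: "card (UNIV :: 'a set) = 3" and S: "subgroup S SymGroup"
    and trans: "\<And>c. (\<lambda>x. x + c) \<in> S"
  shows "Alt \<subseteq> S"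
proof (rule Alt_subset_if_3cycles[OF S])
  fix a b c :: 'a assume d: "distinct [a, b, c]"
  then have U: "{a, b, c} = UNIV" using q by (intro card_subset_eq) auto
  have three: "x + x + x = 0" for x :: 'a
  proof -
    have "(of_nat 3 :: 'a) = 0"
      using CHAR_dvd_CARD[where ?'a = 'a] q by (simp only: of_nat_eq_0_iff_char_dvd)
    then have "3 * x = 0" by simp
    then show ?thesis by (simp add: algebra_simps)
  qed
  let ?t = "\<lambda>x. x + (b - a)"
  have "?t b \<noteq> b" "?t b \<noteq> a"
  proof -
    show "?t b \<noteq> b" using d by auto
    show "?t b \<noteq> a"
    proof
      assume "?t b = a"
      define e where "e = b - a"
      have "e + e = ?t b - a" by (simp add: e_def)
      then have "e + e = 0" using \<open>?t b = a\<close> by simp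
      then have "e = 0" using three[of e] by (simp only: add_0_left)
      then show False using d by (simp add: e_def)
    qed
  qed
  then have tb: "?t b = c" using U by blast
  have "?t c = b + (b - a) + (b - a)" by (simp add: tb[symmetric])
  also have "\<dots> = a + ((b - a) + (b - a) + (b - a))" by (simp add: algebra_simps)
  also have "\<dots> = a" by (simp only: three add_0_right)
  finally have "cycle_of_list [a, b, c] x = ?t x" for x
    using U tb cycle3_simps[OF d] by (cases "x = a"; cases "x = b"; cases "x = c") auto
  then show "cycle_of_list [a, b, c] \<in> S" using trans[of "b - a"] by (metis ext)
qed

lemma P_comp_3:
  assumes q: "card (UNIV :: 'a::{field,finite} set) = 3"
  shows "(P_comp :: ('a \<Rightarrow> 'a) set) = Alt"
proof
  show "(P_comp :: ('a \<Rightarrow> 'a) set) \<subseteq> Alt"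
  proof (rule P_comp_subset[OF subgroup_Alt])
    fix f :: "'a \<Rightarrow> 'a" assume f: "complete_mapping f"
    then have "evenperm f"
      using even_translation[where ?'a = 'a] complete_mapping_3_is_translation[OF q f] q by (metis order_refl)
    then show "f \<in> Alt" using complete_mapping_bij(1)[OF f] by (simp add: Alt_def carrier_SymGroup)
  qed
  have "odd (card (UNIV :: 'a set))" using q by simp
  then have "(1::'a) \<noteq> -1" by (rule one_neq_minus_one_if_odd_card)
  then have "(\<lambda>x. 1 * x + c) \<in> P_comp" for c :: 'a
    by (intro complete_mapping_in_P_comp complete_mapping_affine) auto
  then show "Alt \<subseteq> (P_comp :: ('a \<Rightarrow> 'a) set)"
    by (intro Alt_subset_if_translations_3[OF q subgroup_P_comp]) simp
qed

lemma P_orth_3: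
  assumes q: "card (UNIV :: 'a::{field,finite} set) = 3"
  shows "(P_orth :: ('a \<Rightarrow> 'a) set) = carrier SymGroup"
proof (rule Sym_if_Alt_and_odd[OF subgroup_P_orth _ uminus_in_P_orth])
  have "odd (card (UNIV :: 'a set))" using q by simp
  then have ne: "(1::'a) \<noteq> -1" by (rule one_neq_minus_one_if_odd_card)
  have "(\<lambda>x. x + c) \<in> P_orth" for c :: 'a
  proof -
    have "orthomorphism (\<lambda>x. - x + c)"
      using complete_mapping_affine[of 1 "- c"] ne by (simp add: orthomorphism_iff_complete_uminus)
    then have "(\<lambda>x. - x + c) \<circ> uminus \<in> P_orth"
      by (intro subgroup_SymGroupD(3)[OF subgroup_P_orth] uminus_in_P_orth orthomorphism_in_P_orth)
    then show ?thesis by (simp add: o_def add.commute)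
  qed
  then show "Alt \<subseteq> (P_orth :: ('a \<Rightarrow> 'a) set)"
    by (rule Alt_subset_if_translations_3[OF q subgroup_P_orth])
  have "{0, 1, -1 :: 'a} = UNIV" by (rule card_subset_eq) (use q ne in auto)
  then have "x = 0 \<or> x = 1 \<or> x = -1" for x :: 'a by blast
  then have "- x = transpose 1 (-1) x" for x :: 'a using ne by (metis minus_minus minus_zero transpose_apply_first transpose_apply_other transpose_apply_second zero_neq_one neg_equal_0_iff_equal)
  then have "(uminus :: 'a \<Rightarrow> 'a) = transpose 1 (-1)" by (rule ext)
  from arg_cong[OF this, of evenperm] show "\<not> evenperm (uminus :: 'a \<Rightarrow> 'a)"
    using evenperm_swap[of "1::'a" "-1"] ne by blast
qed

text \<open>
  The value \<open>w = f 1\<close> differs from \<open>0\<close> and \<open>1\<close>, so the field consists of \<open>0, 1, w, w + 1\<close>; the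
  injectivity of \<open>f\<close> and \<open>x + f x\<close> then leaves \<open>w\<close> and \<open>w + 1\<close> a single possible image each.
\<close>

lemma complete_mapping_4_is_3cycle:
  assumes q: "card (UNIV :: 'a::{field,finite} set) = 4"
    and f: "complete_mapping (f :: 'a::{field,finite} \<Rightarrow> 'a)" "f 0 = 0"
  obtains a b c :: "'a::{field,finite}" where "distinct [a, b, c]" "f = cycle_of_list [a, b, c]"
proof -
  have inj: "inj f" "inj (\<lambda>x. x + f x)" using f(1) by (auto simp: complete_mapping_def bij_is_inj)
  have two: "x + x = 0" for x :: 'a using char_2_if_card_power_of_2[of 2 x] q by simp
  have two': "x + (x + y) = y" for x y :: 'a using two by (simp add: add.assoc[symmetric])
  define w where "w = f 1"
  have w0: "w \<noteq> 0" using injD[OF inj(1), of 1 0] f(2) by (auto simp: w_def)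
  have w1: "w \<noteq> 1" using injD[OF inj(2), of 1 0] f(2) two[of 1] by (auto simp: w_def)
  have d: "distinct [0, 1, w, w + 1]"
    using w0 w1 two'[of w 1] two[of w] two[of 1] by (auto simp del: one_add_one) (metis add.commute add_0_right two')+
  then have U: "{0, 1, w, w + 1} = UNIV" using q by (intro card_subset_eq) auto
  then have ex: "x = 0 \<or> x = 1 \<or> x = w \<or> x = w + 1" for x by blast
  have "f w \<noteq> 0" using injD[OF inj(1), of w 0] f(2) w0 by auto
  moreover have "f w \<noteq> w" using injD[OF inj(1), of w 1] w1 by (auto simp: w_def)
  moreover have "f w \<noteq> 1" using injD[OF inj(2), of w 1] w1 by (auto simp: w_def add.commute)
  ultimately have fw: "f w = w + 1" using ex[of "f w"] by blast
  have "f (w + 1) \<noteq> 0" using injD[OF inj(1), of "w + 1" 0] f(2) d by auto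
  moreover have "f (w + 1) \<noteq> w" using injD[OF inj(1), of "w + 1" 1] w0 by (auto simp: w_def)
  moreover have "f (w + 1) \<noteq> w + 1" using injD[OF inj(1), of "w + 1" w] fw by auto
  ultimately have fw1: "f (w + 1) = 1" using ex[of "f (w + 1)"] by blast
  have d': "distinct [1, w, w + 1]" using d by simp
  have "f x = cycle_of_list [1, w, w + 1] x" for x
    using ex[of x] cycle3_simps[OF d'] fw fw1 f(2) w_def cycle3_outside[of 0 1 w "w + 1"] d by auto
  then have "f = cycle_of_list [1, w, w + 1]" by (rule ext)
  then show ?thesis using that[OF d'] by blast
qed

lemma P_comp_4:
  assumes q: "card (UNIV :: 'a::{field,finite} set) = 4"
  shows "(P_comp :: ('a \<Rightarrow> 'a) set) = Alt"
proof
  show "(P_comp :: ('a \<Rightarrow> 'a) set) \<subseteq> Alt"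
  proof (rule P_comp_subset[OF subgroup_Alt])
    fix f :: "'a \<Rightarrow> 'a" assume f: "complete_mapping f"
    have "complete_mapping (\<lambda>x. f x + - f 0)" using f by (rule complete_mapping_add_const)
    then obtain a b c where d: "distinct [a, b, c]" and g: "(\<lambda>x. f x + - f 0) = cycle_of_list [a, b, c]"
      using complete_mapping_4_is_3cycle[OF q, of "\<lambda>x. f x + - f 0"] by (metis add.right_inverse)
    have f_eq: "f = (\<lambda>x. x + f 0) \<circ> cycle_of_list [a, b, c]" unfolding g[symmetric] by auto
    have "evenperm (cycle_of_list [a, b, c])" by (subst evenperm_cycle_of_list[OF d]) simp_all
    moreover have "evenperm (\<lambda>x. x + f 0)" by (rule even_translation) (simp add: q)
    moreover have "permutation (\<lambda>x. x + f 0)"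
      using bij_affine[of 1 "f 0"] by (simp add: permutation_finite)
    ultimately have "evenperm ((\<lambda>x. x + f 0) \<circ> cycle_of_list [a, b, c])"
      by (subst evenperm_comp[OF _ permutation_of_cycle]) simp_all
    then have "evenperm f" by (subst f_eq)
    then show "f \<in> Alt" using complete_mapping_bij(1)[OF f] by (simp add: Alt_def carrier_SymGroup)
  qed
  have "card {0, 1 :: 'a} \<noteq> card (UNIV :: 'a set)" by (simp add: q)
  then have "{0, 1} \<noteq> (UNIV :: 'a set)" by (rule contrapos_nn) (simp only:)
  then obtain w :: 'a where w: "w \<noteq> 0" "w \<noteq> 1" by blast
  have "- 1 = (1::'a)" using char_2_if_card_power_of_2[of 2 "1::'a"] q by (intro minus_unique) simp
  then have w': "w \<noteq> -1" using w(2) by (simp only: not_False_eq_True)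
  have "complete_mapping (\<lambda>x. w * x)" using complete_mapping_affine[OF w(1) w', of 0] by simp
  then obtain a b c where d: "distinct [a, b, c]" and wc: "(\<lambda>x. w * x) = cycle_of_list [a, b, c]"
    using complete_mapping_4_is_3cycle[OF q, of "\<lambda>x. w * x"] by (metis mult_zero_right)
  have "cycle_of_list [a, b, c] \<in> P_comp"
    using complete_mapping_in_P_comp[OF \<open>complete_mapping (\<lambda>x. w * x)\<close>] by (simp only: wc)
  then show "Alt \<subseteq> (P_comp :: ('a \<Rightarrow> 'a) set)"
    using q by (intro Alt_subset_if_3cycle_and_affine[OF subgroup_P_comp affine_in_P_comp d]) simp_all
qed

section \<open>Exhaustive search for complete mappings\<close>

text \<open>
  Graphs of functions defined on \<open>xs\<close> and \<open>z\<close>, with values in \<open>es\<close> and \<open>z\<close> sent to itself, that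
  are injective and stay so after adding the identity with respect to \<open>op\<close>. The search is
  written for an arbitrary operation, so that it can run on concrete codes for the field
  elements.
\<close>

fun partial_cms :: "('b \<Rightarrow> 'b \<Rightarrow> 'b) \<Rightarrow> 'b \<Rightarrow> 'b list \<Rightarrow> 'b list \<Rightarrow> ('b \<times> 'b) list list" where
  "partial_cms op z es [] = [[(z, z)]]"
| "partial_cms op z es (x # xs) =
     concat (map (\<lambda>g. map (\<lambda>v. (x, v) # g)
       (filter (\<lambda>v. list_all (\<lambda>(y, w). w \<noteq> v \<and> op y w \<noteq> op x v) g) es))
     (partial_cms op z es xs))"

definition graph_additive :: "('b \<Rightarrow> 'b \<Rightarrow> 'b) \<Rightarrow> ('b \<times> 'b) list \<Rightarrow> bool" where
  "graph_additive op g \<longleftrightarrow> list_all (\<lambda>(x, v). list_all (\<lambda>(y, w). list_all (\<lambda>(s, t).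
     s = op x y \<longrightarrow> t = op v w) g) g) g"

lemma partial_cms_complete:
  assumes F: "\<And>x. x \<in> X \<Longrightarrow> F x \<in> set es" "F z = z" "inj_on F X" "inj_on (\<lambda>x. op x (F x)) X"
    and "distinct (xs @ [z])" "set (xs @ [z]) \<subseteq> X"
  shows "map (\<lambda>x. (x, F x)) (xs @ [z]) \<in> set (partial_cms op z es xs)"
  using assms(5,6)
proof (induction xs)
  case (Cons x xs)
  let ?g = "map (\<lambda>x. (x, F x)) (xs @ [z])"
  have "F y \<noteq> F x \<and> op y (F y) \<noteq> op x (F x)" if "y \<in> set (xs @ [z])" for y
    using that Cons.prems inj_onD[OF F(3), of y x] inj_onD[OF F(4), of y x] by auto
  then have "list_all (\<lambda>(y, w). w \<noteq> F x \<and> op y w \<noteq> op x (F x)) ?g"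
    unfolding list_all_iff by auto
  moreover have "F x \<in> set es" using F(1) Cons.prems(2) by simp
  moreover have "?g \<in> set (partial_cms op z es xs)" using Cons by simp
  ultimately have "(x, F x) # ?g \<in> set (partial_cms op z es (x # xs))"
    unfolding partial_cms.simps set_concat set_map image_image
    by (intro UN_I[of ?g]) (simp_all only: set_map set_filter image_iff mem_Collect_eq, blast)
  then show ?case by simp
qed (simp add: F(2))

text \<open>
  The coding \<open>e\<close> turns the addition of the field into an executable operation \<open>op\<close>, and a
  complete mapping fixing \<open>0\<close> into one of the graphs found by the search.
\<close>

lemma complete_mapping_additive_by_search:
  fixes e :: "'b \<Rightarrow> 'a::{field,finite}" and f :: "'a \<Rightarrow> 'a"
  assumes e: "bij_betw e (set es) UNIV" "e z = 0"
    and op: "\<And>i j. i \<in> set es \<Longrightarrow> j \<in> set es \<Longrightarrow> op i j \<in> set es \<and> e (op i j) = e i + e j"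
    and xs: "set (xs @ [z]) = set es" "distinct (xs @ [z])"
    and search: "list_all (graph_additive op) (partial_cms op z es xs)"
    and f: "complete_mapping f" "f 0 = 0"
  shows "f (x + y) = f x + f y"
proof -
  define F where "F i = inv_into (set es) e (f (e i))" for i
  have F: "F i \<in> set es" "e (F i) = f (e i)" for i
    using e(1) unfolding F_def bij_betw_def by (metis UNIV_I inv_into_into, metis UNIV_I f_inv_into_f)
  have inj_e: "i = j" if "e i = e j" "i \<in> set es" "j \<in> set es" for i j
    using e(1) that unfolding bij_betw_def by (meson inj_onD)
  have "inj_on F (set es)"
  proof (rule inj_onI)
    fix i j assume ij: "i \<in> set es" "j \<in> set es" "F i = F j"
    then have "f (e i) = f (e j)" using F(2) by metis
    then show "i = j" using inj_e ij injD[OF bij_is_inj[OF complete_mapping_bij(1)[OF f(1)]]] by blast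
  qed
  moreover have "inj_on (\<lambda>i. op i (F i)) (set es)"
  proof (rule inj_onI)
    fix i j assume ij: "i \<in> set es" "j \<in> set es" "op i (F i) = op j (F j)"
    then have "e i + f (e i) = e j + f (e j)" using F op by metis
    then show "i = j" using inj_e ij injD[OF bij_is_inj[OF complete_mapping_bij(2)[OF f(1)]]] by blast
  qed
  moreover have z: "z \<in> set es" using xs(1) by auto
  moreover have "F z = z" by (rule inj_e) (simp_all add: F z e(2) f(2))
  ultimately have "map (\<lambda>i. (i, F i)) (xs @ [z]) \<in> set (partial_cms op z es xs)"
    using F(1) xs by (intro partial_cms_complete[where X = "set es"]) auto
  then have "graph_additive op (map (\<lambda>i. (i, F i)) (xs @ [z]))"
    using search by (simp only: list_all_iff)
  then have "\<forall>i\<in>set es. \<forall>j\<in>set es. \<forall>k\<in>set es. k = op i j \<longrightarrow> F k = op (F i) (F j)"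
    unfolding graph_additive_def list_all_iff set_map xs(1) by simp
  then have hom: "F (op i j) = op (F i) (F j)" if "i \<in> set es" "j \<in> set es" for i j
    using that op by blast
  obtain i j where ij: "i \<in> set es" "x = e i" "j \<in> set es" "y = e j"
    using e(1) unfolding bij_betw_def by (metis UNIV_I imageE)
  have "f (e i + e j) = e (F (op i j))" using op ij F(2) by metis
  also have "\<dots> = f (e i) + f (e j)" using hom ij op F by metis
  finally show ?thesis using ij by simp
qed

fun xor3 :: "bool \<times> bool \<times> bool \<Rightarrow> bool \<times> bool \<times> bool \<Rightarrow> bool \<times> bool \<times> bool" where
  "xor3 (a, b, c) (a', b', c') = (a \<noteq> a', b \<noteq> b', c \<noteq> c')"

definition bits3 :: "(bool \<times> bool \<times> bool) list" where
  "bits3 = [(True, True, True), (True, True, False), (True, False, True), (True, False, False),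
     (False, True, True), (False, True, False), (False, False, True)]"

lemma search_8:
  "list_all (graph_additive xor3)
     (partial_cms xor3 (False, False, False) (bits3 @ [(False, False, False)]) bits3)"
  by code_simp

definition add5 :: "nat \<Rightarrow> nat \<Rightarrow> nat" where "add5 i j = (i + j) mod 5"

lemma search_5:
  "list_all (graph_additive add5) (partial_cms add5 0 [0,1,2,3,4] [1,2,3,4])"
  by code_simp

section \<open>The fields with five and eight elements\<close>

lemma P_comp_subset_AGL:
  assumes "\<And>f x y. complete_mapping (f :: 'a::{field,finite} \<Rightarrow> 'a) \<Longrightarrow> f 0 = 0 \<Longrightarrow> f (x + y) = f x + f y"
  shows "(P_comp :: ('a \<Rightarrow> 'a) set) \<subseteq> AGL"
proof (rule P_comp_subset[OF subgroup_AGL])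
  fix f :: "'a \<Rightarrow> 'a" assume "complete_mapping f"
  then have g: "complete_mapping (\<lambda>x. f x + - f 0)" by (rule complete_mapping_add_const)
  show "f \<in> AGL"
    unfolding AGL_iff
  proof (intro exI conjI allI)
    show "bij (\<lambda>x. f x + - f 0)" using g by (rule complete_mapping_bij)
    show "f (x + y) + - f 0 = (f x + - f 0) + (f y + - f 0)" for x y
      by (rule assms[OF g]) simp
    show "f = (\<lambda>x. f x + - f 0 + f 0)" by simp
  qed
qed

lemma AGL_subset_P_comp:
  assumes "card (UNIV :: 'a::{field,finite} set) \<ge> 4"
    and "\<And>A. bij A \<Longrightarrow> (\<And>x y. A (x + y) = A x + A y) \<Longrightarrow> A \<in> (P_comp :: ('a \<Rightarrow> 'a) set)"
  shows "AGL \<subseteq> (P_comp :: ('a \<Rightarrow> 'a) set)"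
proof
  fix f :: "'a \<Rightarrow> 'a" assume "f \<in> AGL"
  then obtain A b where A: "bij A" "\<And>x y. A (x + y) = A x + A y" and f: "f = (\<lambda>x. 1 * x + b) \<circ> A"
    unfolding AGL_iff by (auto simp: o_def)
  have "(\<lambda>x. 1 * x + b) \<in> P_comp" by (rule affine_in_P_comp[OF assms(1)]) simp
  then show "f \<in> P_comp"
    unfolding f using assms(2)[OF A] by (rule subgroup_SymGroupD(3)[OF subgroup_P_comp])
qed

text \<open>
  One inclusion is the exhaustive search over complete mappings fixing \<open>0\<close>, with the field
  elements coded by their coordinates in a basis \<open>1, u, v\<close> over the field with two elements. The
  other one is the generation of the linear group by transvections.
\<close>

lemma P_comp_8:
  assumes q: "card (UNIV :: 'a::{field,finite} set) = 8"
  shows "(P_comp :: ('a \<Rightarrow> 'a) set) = AGL"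
proof
  have two: "x + x = 0" for x :: 'a using char_2_if_card_power_of_2[of 3 x] q by simp
  have two': "x + (x + y) = y" for x y :: 'a using two by (simp add: add.assoc[symmetric])
  show "AGL \<subseteq> (P_comp :: ('a \<Rightarrow> 'a) set)"
    using q by (intro AGL_subset_P_comp additive_bij_in_P_comp two) auto
  have big: "\<exists>y. y \<notin> set ys" if "length ys \<le> 4" for ys :: "'a list"
  proof -
    have "set ys \<noteq> UNIV" using q that card_length[of ys] by auto
    then show ?thesis by blast
  qed
  obtain u :: 'a where u: "u \<notin> {0, 1}" using big[of "[0, 1]"] by auto
  obtain v where v: "v \<notin> {0, 1, u, 1 + u}" using big[of "[0, 1, u, 1 + u]"] by auto
  define e where "e = (\<lambda>(a, b, c). (if a then 1 else 0) + (if b then u else 0) + (if c then v else 0))"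
  let ?es = "bits3 @ [(False, False, False)]"
  have U: "set ?es = UNIV" "distinct ?es"
    by (auto simp: bits3_def)
  have e_add: "e (xor3 i j) = e i + e j" for i j
    by (cases i; cases j) (auto simp: e_def ac_simps two two')
  have "inj e"
  proof (rule injI)
    fix i j assume "e i = e j"
    then have 0: "e (xor3 i j) = 0" using e_add two by simp
    have ne: "u \<noteq> 0" "u \<noteq> 1" "v \<noteq> 0" "v \<noteq> 1" "v \<noteq> u" "v \<noteq> 1 + u" using u v by auto
    have "x \<noteq> y \<Longrightarrow> x + y \<noteq> 0" for x y :: 'a using two' by (metis add_0_right)
    then have "1 + u \<noteq> 0" "1 + v \<noteq> 0" "u + v \<noteq> 0" "1 + u + v \<noteq> 0" using ne by metis+
    with 0 ne have "xor3 i j = (False, False, False)"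
      by (cases "xor3 i j") (auto simp: e_def split: if_splits)
    then show "i = j" by (cases i; cases j) auto
  qed
  moreover have "range e = (UNIV :: 'a set)"
  proof (rule card_subset_eq)
    have "card (UNIV :: (bool \<times> bool \<times> bool) set) = 8"
      by (simp only: U(1)[symmetric] distinct_card[OF U(2)]) (simp add: bits3_def)
    then show "card (range e) = card (UNIV :: 'a set)" using card_image[OF \<open>inj e\<close>] q by simp
  qed auto
  ultimately have "bij_betw e (set ?es) UNIV" unfolding U(1) by (simp add: bij_betw_def)
  moreover have "e (False, False, False) = 0" by (simp add: e_def)
  moreover have "xor3 i j \<in> set ?es \<and> e (xor3 i j) = e i + e j" for i j
    by (simp only: U(1) UNIV_I e_add simp_thms)
  ultimately show "(P_comp :: ('a \<Rightarrow> 'a) set) \<subseteq> AGL"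
    by (intro P_comp_subset_AGL complete_mapping_additive_by_search[OF _ _ _ refl U(2) search_8])
qed

text \<open>
  Over a prime field additive permutations are multiplications, so the affine group is already
  generated by the complete mappings of the form \<open>a x + b\<close>; that there are no others comes from
  the search, run modulo 5.
\<close>

lemma P_comp_5:
  assumes q: "card (UNIV :: 'a::{field,finite} set) = 5"
  shows "(P_comp :: ('a \<Rightarrow> 'a) set) = AGL"
proof
  let ?e = "of_nat :: nat \<Rightarrow> 'a"
  have five: "?e 5 = 0"
    using CHAR_dvd_CARD[where ?'a = 'a] q by (simp only: of_nat_eq_0_iff_char_dvd)
  have char: "CHAR('a) = 5"
  proof -
    have "CHAR('a) dvd 5" using five by (simp only: of_nat_eq_0_iff_char_dvd)
    moreover have "prime (5::nat)" by simp
    ultimately have "CHAR('a) = 1 \<or> CHAR('a) = 5" unfolding prime_nat_iff by blast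
    moreover have "CHAR('a) \<noteq> 1" using of_nat_eq_0_iff_char_dvd[where ?'a = 'a, of 1] by auto
    ultimately show ?thesis by blast
  qed
  have "inj_on ?e {..<5}"
    by (rule inj_onI) (simp add: of_nat_eq_iff_cong_CHAR char cong_def)
  moreover have es: "set [0, 1, 2, 3, 4] = {..<5::nat}" by auto
  ultimately have inj: "inj_on ?e (set [0, 1, 2, 3, 4])" by (simp only:)
  moreover have "?e ` set [0, 1, 2, 3, 4] = UNIV"
  proof (rule card_subset_eq)
    have "card (?e ` set [0, 1, 2, 3, 4]) = card (set [0, 1, 2, 3, 4 :: nat])"
      by (rule card_image[OF inj])
    also have "\<dots> = card (UNIV :: 'a set)" unfolding es q by simp
    finally show "card (?e ` set [0, 1, 2, 3, 4]) = card (UNIV :: 'a set)" .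
  qed auto
  ultimately have e: "bij_betw ?e (set [0, 1, 2, 3, 4]) UNIV" unfolding bij_betw_def ..
  have e_add: "?e (add5 i j) = ?e i + ?e j" for i j
    unfolding add5_def of_nat_add[symmetric] of_nat_eq_iff_cong_CHAR char by (simp add: cong_def)
  have "add5 i j \<in> set [0, 1, 2, 3, 4] \<and> ?e (add5 i j) = ?e i + ?e j" for i j
    unfolding es e_add by (simp add: add5_def)
  moreover have "set ([1, 2, 3, 4] @ [0]) = set [0, 1, 2, 3, 4 :: nat]" "distinct ([1, 2, 3, 4] @ [0 :: nat])"
    by auto
  ultimately show "(P_comp :: ('a \<Rightarrow> 'a) set) \<subseteq> AGL"
    using of_nat_0 by (intro P_comp_subset_AGL complete_mapping_additive_by_search[OF e _ _ _ _ search_5])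
  show "AGL \<subseteq> (P_comp :: ('a \<Rightarrow> 'a) set)"
  proof (rule AGL_subset_P_comp)
    show q4: "card (UNIV :: 'a set) \<ge> 4" using q by simp
    fix A :: "'a \<Rightarrow> 'a" assume A: "bij A" "\<And>x y. A (x + y) = A x + A y"
    have lin: "A x = A 1 * x" for x
    proof -
      obtain n where "x = ?e n" using e unfolding bij_betw_def by blast
      then show ?thesis using additive_of_nat_mult[OF A(2), of n 1] by (simp add: mult.commute)
    qed
    have A1: "A 1 \<noteq> 0"
    proof
      assume "A 1 = 0"
      then have "A 0 = A 1" using lin[of 0] by simp
      then show False using injD[OF bij_is_inj[OF A(1)], of 0 1] by simp
    qed
    have eq: "A = (\<lambda>x. A 1 * x + 0)"
    proof (rule ext)
      show "A x = A 1 * x + 0" for x using lin[of x] by (simp only: add_0_right)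
    qed
    show "A \<in> P_comp" by (subst eq) (rule affine_in_P_comp[OF q4 A1])
  qed
qed

section \<open>The classification\<close>

theorem theorem1p1p2:
  fixes q :: nat
  assumes "primepow q"
    and "card (UNIV :: 'a::{field,finite} set) = q"
  shows "(q \<notin> {2, 3, 4, 5, 8} \<longrightarrow>
            (P_comp :: ('a \<Rightarrow> 'a) set) = carrier SymGroup \<and>
            (P_orth :: ('a \<Rightarrow> 'a) set) = carrier SymGroup) \<and>
         (q = 2 \<longrightarrow>
            (P_comp :: ('a \<Rightarrow> 'a) set) = {id} \<and>
            (P_orth :: ('a \<Rightarrow> 'a) set) = {id}) \<and>
         (q = 3 \<longrightarrow>
            (P_comp :: ('a \<Rightarrow> 'a) set) = Alt \<and>
            (P_orth :: ('a \<Rightarrow> 'a) set) = carrier SymGroup) \<and>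
         (q = 4 \<longrightarrow>
            (P_comp :: ('a \<Rightarrow> 'a) set) = Alt \<and>
            (P_orth :: ('a \<Rightarrow> 'a) set) = Alt) \<and>
         (q = 5 \<longrightarrow>
            (P_comp :: ('a \<Rightarrow> 'a) set) = AGL \<and>
            (P_orth :: ('a \<Rightarrow> 'a) set) = AGL) \<and>
         (q = 8 \<longrightarrow>
            (P_comp :: ('a \<Rightarrow> 'a) set) = AGL \<and>
            (P_orth :: ('a \<Rightarrow> 'a) set) = AGL) \<and>
         (q \<ge> 3 \<longrightarrow>
            primitive_perm_group (P_comp :: ('a \<Rightarrow> 'a) set) UNIV \<and>
            primitive_perm_group (P_orth :: ('a \<Rightarrow> 'a) set) UNIV)"
proof (intro conjI impI)
  note q = assms(2)
  have orth: "(P_orth :: ('a \<Rightarrow> 'a) set) = P_comp" if "q \<ge> 4"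
    using that q by (intro P_orth_eq_P_comp) simp
  have large: "(P_comp :: ('a \<Rightarrow> 'a) set) = carrier SymGroup \<and> q \<ge> 4" if "q \<notin> {2, 3, 4, 5, 8}"
  proof -
    obtain p k where pk: "prime p" "k > 0" "q = p ^ k" using assms(1) by (auto simp: primepow_def)
    have "p ^ k \<ge> 2 ^ 1"
      using pk prime_ge_2_nat[OF pk(1)] by (metis One_nat_def Suc_leI order_trans power_increasing power_mono one_le_numeral zero_le)
    then have "q \<ge> 2" using pk by simp
    show ?thesis
    proof (cases "even q")
      case True
      then have "p = 2" using pk by (metis prime_dvd_power primes_dvd_imp_eq two_is_prime_nat)
      then have "k \<noteq> 1" "k \<noteq> 2" "k \<noteq> 3" using that pk by auto
      then have "k \<ge> 4" using pk(2) by linarith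
      then have "(2::nat) ^ 4 \<le> 2 ^ k" by (rule power_increasing) simp
      then have "q > 10" using pk(3) \<open>p = 2\<close> by simp
      then show ?thesis using P_comp_even[where ?'a = 'a, of k] q pk(3) \<open>p = 2\<close> by simp
    next
      case False
      then have "q \<ge> 7" using that \<open>q \<ge> 2\<close> by simp presburger
      then show ?thesis using P_comp_odd[where ?'a = 'a] False q by simp
    qed
  qed
  show "(P_comp :: ('a \<Rightarrow> 'a) set) = carrier SymGroup" if "q \<notin> {2, 3, 4, 5, 8}"
    using large[OF that] by blast
  show "(P_orth :: ('a \<Rightarrow> 'a) set) = carrier SymGroup" if "q \<notin> {2, 3, 4, 5, 8}"
    using large[OF that] orth by blast
  show "(P_comp :: ('a \<Rightarrow> 'a) set) = {id}" "(P_orth :: ('a \<Rightarrow> 'a) set) = {id}" if "q = 2"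
    using P_trivial_2[where ?'a = 'a] q that by auto
  show "(P_comp :: ('a \<Rightarrow> 'a) set) = Alt" "(P_orth :: ('a \<Rightarrow> 'a) set) = carrier SymGroup" if "q = 3"
    using P_comp_3[where ?'a = 'a] P_orth_3[where ?'a = 'a] q that by auto
  show "(P_comp :: ('a \<Rightarrow> 'a) set) = Alt" "(P_orth :: ('a \<Rightarrow> 'a) set) = Alt" if "q = 4"
    using P_comp_4[where ?'a = 'a] orth q that by auto
  show "(P_comp :: ('a \<Rightarrow> 'a) set) = AGL" "(P_orth :: ('a \<Rightarrow> 'a) set) = AGL" if "q = 5"
    using P_comp_5[where ?'a = 'a] orth q that by auto
  show "(P_comp :: ('a \<Rightarrow> 'a) set) = AGL" "(P_orth :: ('a \<Rightarrow> 'a) set) = AGL" if "q = 8"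
    using P_comp_8[where ?'a = 'a] orth q that by auto
  have prim: "primitive_perm_group (P_comp :: ('a \<Rightarrow> 'a) set) UNIV" if "q \<ge> 4"
    using that q by (intro primitive_if_affine subgroup_P_comp affine_in_P_comp) simp_all
  show "primitive_perm_group (P_comp :: ('a \<Rightarrow> 'a) set) UNIV" if "q \<ge> 3"
  proof (cases "q = 3")
    case True
    then show ?thesis
      using P_comp_3[where ?'a = 'a] q by (intro primitive_if_3cycles subgroup_P_comp) simp_all
  qed (use prim that in simp)
  show "primitive_perm_group (P_orth :: ('a \<Rightarrow> 'a) set) UNIV" if "q \<ge> 3"
  proof (cases "q = 3")
    case True
    then show ?thesis
      using P_orth_3[where ?'a = 'a] q
      by (intro primitive_if_3cycles subgroup_P_orth) (auto simp: Alt_def)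
  qed (use prim orth that in simp)
qed

end
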